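(* Let $n\ge 1$, let $\mathbf{A},\mathbf{B}\in \mathrm{M}(n,\mathbb{H})$ be given, and consider the left matrix equation $\mathbf{X}\mathbf{A}=\mathbf{B}$ with unknown $\mathbf{X}=(x_{ij})\in \mathrm{M}(n,\mathbb{H})$. If $\mathrm{ddet}\,\mathbf{A}\neq 0$, then this equation has a unique solution, and the solution is given by $$x_{ij}=\frac{\mathrm{rdet}_{j}\,(\mathbf{A}\mathbf{A}^{*})_{j.}\left(\check{\mathbf{b}}_{i.}\right)}{\mathrm{ddet}\,\mathbf{A}}\qquad\text{for all } i,j=1,\ldots,n,$$ where $\check{\mathbf{b}}_{i.}$ is the $i$th row of $\check{\mathbf{B}}:=\mathbf{B}\mathbf{A}^{*}$.
   Context: $\mathbb{H}$ is the (real) quaternion skew field and $\mathrm{M}(n,\mathbb{H})$ the ring of $n\times n$ quaternion matrices. For $\mathbf{A}=(a_{ij})$, $\mathbf{A}^{*}$ is the Hermitian adjoint (conjugate transpose); $\mathbf{A}$ is Hermitian if $\mathbf{A}^*=\mathbf{A}$. For a square matrix $\mathbf{M}$ and a row $\mathbf{b}$, $\mathbf{M}_{j.}(\mathbf{b})$ denotes the matrix obtained from $\mathbf{M}$ by replacing its $j$th row with $\mathbf{b}$. Row determinants. For $\mathbf{A}=(a_{ij})\in \mathrm{M}(n,\mathbb{H})$ and $i\in\{1,\ldots,n\}$, $$\mathrm{rdet}_i\,\mathbf{A}=\sum_{\sigma\in S_n}(-1)^{n-r}\,\bigl(a_{i\,i_{k_1}}a_{i_{k_1}i_{k_1+1}}\cdots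 a_{i_{k_1+l_1}i}\bigr)\cdots\bigl(a_{i_{k_r}i_{k_r+1}}\cdots a_{i_{k_r+l_r}i_{k_r}}\bigr),$$ where each $\sigma\in S_n$ is written as a product of its $r$ disjoint cycles (fixed points counted as cycles of length one, contributing a diagonal entry) in the left-ordered form $$\sigma=(i\,i_{k_1}i_{k_1+1}\ldots i_{k_1+l_1})(i_{k_2}i_{k_2+1}\ldots i_{k_2+l_2})\cdots(i_{k_r}i_{k_r+1}\ldots i_{k_r+l_r}),$$ in which $i$ opens the first cycle from the left, and $i_{k_2}<i_{k_3}<\cdots<i_{k_r}$ and $i_{k_t}<i_{k_t+s}$ for $t=2,\ldots,r$, $s=1,\ldots,l_t$. The order of the factors in each product is exactly as written. Column determinants. For $j\in\{1,\ldots,n\}$, $$\mathrm{cdet}_j\,\mathbf{A}=\sum_{\tau\in S_n}(-1)^{n-r}\,\bigl(a_{j_{k_r}j_{k_r+l_r}}\cdots a_{j_{k_r+1}j_{k_r}}\bigr)\cdots\bigl(a_{j\,j_{k_1+l_1}}\cdots a_{j_{k_1+1}j_{k_1}}a_{j_{k_1}j}\bigr),$$ where each $\tau\in S_n$ is written as a product of its $r$ disjoint cycles (fixed points included) in the right-ordered form $$\tau=(j_{k_r+l_r}\ldots j_{k_r+1}j_{k_r})\cdots(j_{k_2+l_2}\ldots j_{k_2+1}j_{k_2})(j_{k_1+l_1}\ldots j_{k_1+1}j_{k_1}j),$$ in which $j$ opens the first cycle from the right, and $j_{k_2}<j_{k_3}<\cdots<j_{k_r}$ and $j_{k_t}<j_{k_t+s}$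 for $t=2,\ldots,r$, $s=1,\ldots,l_t$. Double determinant. It is known that for a Hermitian matrix $\mathbf{M}\in\mathrm{M}(n,\mathbb{H})$ all the values $\mathrm{rdet}_1\mathbf{M},\ldots,\mathrm{rdet}_n\mathbf{M},\mathrm{cdet}_1\mathbf{M},\ldots,\mathrm{cdet}_n\mathbf{M}$ coincide and are real; this common value is $\det\mathbf{M}$. It is also known that $\det(\mathbf{A}^*\mathbf{A})=\det(\mathbf{A}\mathbf{A}^* )$ for $\mathbf{A}\in \mathrm{M}(n,\mathbb{H})$; the double determinant is $\mathrm{ddet}\,\mathbf{A}:=\det(\mathbf{A}^{*}\mathbf{A})=\det(\mathbf{A}\mathbf{A}^{*})\in\mathbb{R}$. *)

theory Defs
  imports "Jordan_Normal_Form.Matrix" "HOL-Combinatorics.Combinatorics"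
begin

section \<open>The skew field of real quaternions\<close>

text \<open>\<open>Quat a b c d\<close> is \<open>a + b i + c j + d k\<close> with \<open>i\<^sup>2 = j\<^sup>2 = k\<^sup>2 = i j k = -1\<close>.\<close>

datatype quat = Quat (qRe: real) (qI: real) (qJ: real) (qK: real)

lemma quat_eqI:
  "qRe x = qRe y \<Longrightarrow> qI x = qI y \<Longrightarrow> qJ x = qJ y \<Longrightarrow> qK x = qK y \<Longrightarrow> x = y"
  by (rule quat.expand) simp

instantiation quat :: ring_1
begin

definition "0 = Quat 0 0 0 0"
definition "1 = Quat 1 0 0 0"
definition "- x = Quat (- qRe x) (- qI x) (- qJ x) (- qK x)"
definition "x + y = Quat (qRe x + qRe y) (qI x + qI y) (qJ x + qJ y) (qK x + qK y)"
definition "x - y = Quat (qRe x - qRe y) (qI x - qI y) (qJ x - qJ y) (qK x - qK y)"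
definition "x * y = Quat
  (qRe x * qRe y - qI x * qI y - qJ x * qJ y - qK x * qK y)
  (qRe x * qI y + qI x * qRe y + qJ x * qK y - qK x * qJ y)
  (qRe x * qJ y - qI x * qK y + qJ x * qRe y + qK x * qI y)
  (qRe x * qK y + qI x * qJ y - qJ x * qI y + qK x * qRe y)"

instance
  by standard
    (auto intro!: quat_eqI simp: zero_quat_def one_quat_def uminus_quat_def plus_quat_def
      minus_quat_def times_quat_def algebra_simps)

end

definition quat_cnj :: "quat \<Rightarrow> quat" where
  "quat_cnj x = Quat (qRe x) (- qI x) (- qJ x) (- qK x)"

definition quat_normsq :: "quat \<Rightarrow> real" where
  "quat_normsq x = (qRe x)\<^sup>2 + (qI x)\<^sup>2 + (qJ x)\<^sup>2 + (qK x)\<^sup>2"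

instantiation quat :: real_div_algebra
begin

definition "r *\<^sub>R x = Quat (r * qRe x) (r * qI x) (r * qJ x) (r * qK x)"

definition "inverse x = (1 / quat_normsq x) *\<^sub>R quat_cnj x"
definition "x div y = x * inverse y" for x y :: quat

lemma quat_normsq_eq_0_iff: "quat_normsq x = 0 \<longleftrightarrow> x = 0"
proof
  assume "quat_normsq x = 0"
  then have "(qRe x)\<^sup>2 = 0" "(qI x)\<^sup>2 = 0" "(qJ x)\<^sup>2 = 0" "(qK x)\<^sup>2 = 0"
    using zero_le_power2[of "qRe x"] zero_le_power2[of "qI x"]
      zero_le_power2[of "qJ x"] zero_le_power2[of "qK x"]
    unfolding quat_normsq_def by linarith+
  then show "x = 0"
    by (auto intro!: quat_eqI simp: zero_quat_def)
qed (simp add: quat_normsq_def zero_quat_def)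

lemma quat_cnj_mult_self:
  "quat_cnj x * x = quat_normsq x *\<^sub>R 1" "x * quat_cnj x = quat_normsq x *\<^sub>R 1"
  by (auto intro!: quat_eqI simp: quat_cnj_def quat_normsq_def times_quat_def one_quat_def
      scaleR_quat_def power2_eq_square)

instance
proof
  fix x y :: quat and a b :: real
  show "a *\<^sub>R (x + y) = a *\<^sub>R x + a *\<^sub>R y" "(a + b) *\<^sub>R x = a *\<^sub>R x + b *\<^sub>R x"
    "a *\<^sub>R b *\<^sub>R x = (a * b) *\<^sub>R x" "1 *\<^sub>R x = x"
    by (auto intro!: quat_eqI simp: scaleR_quat_def plus_quat_def algebra_simps)
  have L: "a *\<^sub>R x * y = a *\<^sub>R (x * y)" and R: "x * a *\<^sub>R y = a *\<^sub>R (x * y)" for a and x y :: quat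
    by (auto intro!: quat_eqI simp: scaleR_quat_def times_quat_def algebra_simps)
  show "a *\<^sub>R x * y = a *\<^sub>R (x * y)" "x * a *\<^sub>R y = a *\<^sub>R (x * y)"
    by (fact L, fact R)
  have S: "(1 / r) *\<^sub>R r *\<^sub>R (1::quat) = 1" if "r \<noteq> 0" for r
    using that by (auto intro!: quat_eqI simp: scaleR_quat_def)
  show "inverse x * x = 1" "x * inverse x = 1" if "x \<noteq> 0"
    using that by (simp_all add: inverse_quat_def L R quat_cnj_mult_self S quat_normsq_eq_0_iff)
  show "x div y = x * inverse y"
    by (rule divide_quat_def)
  show "inverse (0::quat) = 0"
    by (auto intro!: quat_eqI simp: inverse_quat_def quat_cnj_def scaleR_quat_def zero_quat_def)
qed

end

section \<open>Quaternion matrices\<close>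

text \<open>Square matrices of size \<open>n\<close> are elements of \<^term>\<open>carrier_mat n n\<close>; rows and columns are
  indexed by \<open>0, \<dots>, n - 1\<close>.\<close>

definition qadjoint :: "quat mat \<Rightarrow> quat mat" where
  "qadjoint A = map_mat quat_cnj (transpose_mat A)"

definition replace_row :: "'a mat \<Rightarrow> nat \<Rightarrow> 'a vec \<Rightarrow> 'a mat" where
  "replace_row M j b =
     mat (dim_row M) (dim_col M) (\<lambda>(k, l). if k = j then b $ l else M $$ (k, l))"

section \<open>Row and column determinants\<close>

text \<open>For a permutation \<open>\<sigma>\<close>, \<^term>\<open>support \<sigma> x\<close> is the cycle of \<open>\<sigma>\<close> through \<open>x\<close> as the list
  \<open>[x, \<sigma> x, \<sigma> (\<sigma> x), \<dots>]\<close>, of length one if \<open>x\<close> is a fixed point.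
  The list \<open>ordered_cycles n \<sigma> i\<close> is the left-ordered form of \<open>\<sigma>\<close>: the cycle opened by \<open>i\<close>,
  followed by the remaining cycles, each opened by its least element, in the increasing order of
  these elements.\<close>

definition ordered_cycles :: "nat \<Rightarrow> (nat \<Rightarrow> nat) \<Rightarrow> nat \<Rightarrow> nat list list" where
  "ordered_cycles n \<sigma> i = map (support \<sigma>) (i # sorted_list_of_set
     {k. k < n \<and> k \<notin> set (support \<sigma> i) \<and> (\<forall>m \<in> set (support \<sigma> k). k \<le> m)})"

definition cycle_prod :: "quat mat \<Rightarrow> (nat \<Rightarrow> nat) \<Rightarrow> nat list \<Rightarrow> quat" where
  "cycle_prod A \<sigma> c = prod_list (map (\<lambda>x. A $$ (x, \<sigma> x)) c)"

definition rdet :: "nat \<Rightarrow> quat mat \<Rightarrow> quat" where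
  "rdet i A = (\<Sum>\<sigma> | \<sigma> permutes {..<dim_row A}.
     let cs = ordered_cycles (dim_row A) \<sigma> i in
       (-1) ^ (dim_row A - length cs) * prod_list (map (cycle_prod A \<sigma>) cs))"

text \<open>In the right-ordered form the opening element \<open>j\<close> of a cycle \<open>(j\<^sub>l \<dots> j\<^sub>2 j\<^sub>1 j)\<close> is written
  last, so that the permutation sends \<open>j\<close> to \<open>j\<^sub>l\<close> and \<open>j\<^sub>1\<close> to \<open>j\<close>. The word
  \<open>a\<^bsub>j j\<^sub>l\<^esub> \<cdots> a\<^bsub>j\<^sub>2 j\<^sub>1\<^esub> a\<^bsub>j\<^sub>1 j\<^esub>\<close> it contributes is therefore again the product of the entries
  \<open>a\<^bsub>x \<tau>(x)\<^esub>\<close> for \<open>x = j, \<tau> j, \<tau> (\<tau> j), \<dots>\<close>, from left to right; only the order of the cycles is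
  reversed.\<close>

definition cdet :: "nat \<Rightarrow> quat mat \<Rightarrow> quat" where
  "cdet j A = (\<Sum>\<tau> | \<tau> permutes {..<dim_row A}.
     let cs = ordered_cycles (dim_row A) \<tau> j in
       (-1) ^ (dim_row A - length cs) * prod_list (map (cycle_prod A \<tau>) (rev cs)))"

text \<open>The common real value of all row and column determinants; meaningful for Hermitian matrices
  of size at least one.\<close>

definition hdet :: "quat mat \<Rightarrow> real" where
  "hdet M = (THE d. \<forall>i < dim_row M. rdet i M = of_real d \<and> cdet i M = of_real d)"

definition ddet :: "quat mat \<Rightarrow> real" where
  "ddet A = hdet (qadjoint A * A)"

end

theory Submission
  imports Defs
begin

text \<open>For a matrix \<open>f\<close> and a finite index set \<open>S\<close>, let \<open>D S\<close> be the sum over the permutations of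
  \<open>S\<close> of the sign times the real parts of the cycle products (the Moore determinant). Reversing a
  cycle of a Hermitian matrix conjugates its product, so that the row and column determinants of a
  Hermitian matrix are all equal to \<open>D\<close>. By the same cancellation the row determinant along
  \<open>j\<close> vanishes when the \<open>j\<close>th row is replaced by another row. As this determinant is left linear in
  its \<open>j\<close>th row, Cramer's rule follows for \<open>X (A A\<^sup>*) = B A\<^sup>*\<close>.

  The vanishing also makes \<open>D\<close> invariant under simultaneous row and column transvections, hence
  computable by Schur complements. The two Schur complements of the block matrix with blocks
  \<open>1, s A, s A\<^sup>*, 1\<close> give \<open>D (t - A\<^sup>* A) = D (t - A A\<^sup>*)\<close> for \<open>t = s\<^sup>-\<^sup>2 > 0\<close>, and
  \<open>t \<rightarrow> 0\<close> gives \<open>det (A\<^sup>* A) = det (A A\<^sup>*)\<close>.\<close>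

section \<open>Quaternion conjugation\<close>

lemma qRe_simps [simp]:
  "qRe 0 = 0" "qRe 1 = 1" "qRe (x + y) = qRe x + qRe y" "qRe (x - y) = qRe x - qRe y"
  "qRe (- x) = - qRe x" "qRe (r *\<^sub>R x) = r * qRe x" "qRe (of_real r) = r"
  by (simp_all add: zero_quat_def one_quat_def plus_quat_def minus_quat_def uminus_quat_def
      scaleR_quat_def of_real_def)

lemma qRe_sum: "qRe (\<Sum>x\<in>S. f x) = (\<Sum>x\<in>S. qRe (f x))"
  by (induction S rule: infinite_finite_induct) auto

lemma qRe_mult_commute: "qRe (x * y) = qRe (y * x)"
  by (simp add: times_quat_def algebra_simps)

lemma quat_cnj_simps [simp]:
  "quat_cnj 0 = 0" "quat_cnj 1 = 1" "quat_cnj (x + y) = quat_cnj x + quat_cnj y"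
  "quat_cnj (x - y) = quat_cnj x - quat_cnj y" "quat_cnj (- x) = - quat_cnj x"
  "quat_cnj (r *\<^sub>R x) = r *\<^sub>R quat_cnj x" "quat_cnj (of_real r) = of_real r"
  "quat_cnj (quat_cnj x) = x"
  by (auto intro!: quat_eqI simp: quat_cnj_def zero_quat_def one_quat_def plus_quat_def
      minus_quat_def uminus_quat_def scaleR_quat_def of_real_def)

lemma quat_cnj_mult [simp]: "quat_cnj (x * y) = quat_cnj y * quat_cnj x"
  by (auto intro!: quat_eqI simp: quat_cnj_def times_quat_def algebra_simps)

lemma quat_cnj_sum: "quat_cnj (\<Sum>x\<in>S. f x) = (\<Sum>x\<in>S. quat_cnj (f x))"
  by (induction S rule: infinite_finite_induct) auto

lemma quat_add_cnj: "x + quat_cnj x = of_real (2 * qRe x)"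
  by (auto intro!: quat_eqI simp: quat_cnj_def plus_quat_def of_real_def scaleR_quat_def one_quat_def)

section \<open>Lists of distinct elements\<close>

text \<open>A cycle through a fixed element is encoded by the list of its other elements in cyclic
  order, so that sums over cycles become sums over these lists.\<close>

definition dlists :: "'a set \<Rightarrow> 'a list set" where
  "dlists S = {xs. distinct xs \<and> set xs \<subseteq> S}"

lemma finite_dlists [simp]: "finite S \<Longrightarrow> finite (dlists S)"
  using finite_subset_distinct[of S] by (simp add: dlists_def conj_commute)

lemma sum_dlists_rev: "(\<Sum>x\<in>dlists S. g (rev x)) = (\<Sum>x\<in>dlists S. g x)"
  by (rule sum.reindex_bij_witness[of _ rev rev]) (auto simp: dlists_def)

lemma sum_dlists_pairs:
  assumes "finite S"
  shows "(\<Sum>x\<in>dlists S. \<Sum>y\<in>dlists (S - set x). h x y) =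
    (\<Sum>(x, y) | distinct (x @ y) \<and> set (x @ y) \<subseteq> S. h x y)"
proof -
  have "(\<Sum>x\<in>dlists S. \<Sum>y\<in>dlists (S - set x). h x y) =
      (\<Sum>(x, y)\<in>Sigma (dlists S) (\<lambda>x. dlists (S - set x)). h x y)"
    using assms by (subst sum.Sigma) auto
  also have "Sigma (dlists S) (\<lambda>x. dlists (S - set x)) =
      {(x, y). distinct (x @ y) \<and> set (x @ y) \<subseteq> S}"
    by (auto simp: dlists_def)
  finally show ?thesis .
qed

text \<open>Both sides range over the ordered pairs of disjoint distinct lists in \<open>S\<close>,
  a set stable under exchanging the two components.\<close>

lemma sum_dlists_swap:
  assumes "finite S"
  shows "(\<Sum>x\<in>dlists S. \<Sum>y\<in>dlists (S - set x). h x y) =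
    (\<Sum>x\<in>dlists S. \<Sum>y\<in>dlists (S - set x). h y x)"
  unfolding sum_dlists_pairs[OF assms]
  by (rule sum.reindex_bij_witness[of _ prod.swap prod.swap]) auto

text \<open>Separates the lists avoiding \<open>k\<close> from those through \<open>k\<close>. As
  \<open>k\<close> occurs only once, a list of the second kind is cut at \<open>k\<close> in exactly
  one way.\<close>

lemma sum_dlists_split:
  assumes "finite S" "k \<in> S"
  shows "(\<Sum>x\<in>dlists S. g x) = (\<Sum>x\<in>dlists (S - {k}). g x) +
    (\<Sum>x\<in>dlists (S - {k}). \<Sum>y\<in>dlists (S - {k} - set x). g (x @ k # y))"
proof -
  let ?P = "{(x, y). distinct (x @ y) \<and> set (x @ y) \<subseteq> S - {k}}"
  let ?K = "{x \<in> dlists S. k \<in> set x}"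
  have "(\<Sum>x\<in>dlists S. g x) = (\<Sum>x\<in>dlists (S - {k}). g x) + (\<Sum>x\<in>?K. g x)"
  proof -
    have "dlists S = dlists (S - {k}) \<union> ?K" "dlists (S - {k}) \<inter> ?K = {}"
      by (auto simp: dlists_def)
    then show ?thesis
      using assms(1) by (metis (no_types, lifting) finite_Un finite_dlists sum.union_disjoint)
  qed
  also have "(\<Sum>x\<in>?K. g x) = (\<Sum>(x, y)\<in>?P. g (x @ k # y))"
  proof (rule sum.reindex_bij_witness[of _ "\<lambda>(x, y). x @ k # y"
        "\<lambda>z. (takeWhile (\<lambda>x. x \<noteq> k) z, tl (dropWhile (\<lambda>x. x \<noteq> k) z))"])
    fix z assume "z \<in> ?K"
    then obtain x y where z: "z = x @ k # y" and "distinct z" "set z \<subseteq> S"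
      by (auto simp: dlists_def dest!: split_list)
    then have xy: "(x, y) \<in> ?P" by auto
    from xy have "\<forall>v\<in>set x. v \<noteq> k" by auto
    then have *: "takeWhile (\<lambda>x. x \<noteq> k) z = x" "dropWhile (\<lambda>x. x \<noteq> k) z = k # y"
      by (simp_all add: z takeWhile_append2 dropWhile_append2)
    from xy show "(takeWhile (\<lambda>x. x \<noteq> k) z, tl (dropWhile (\<lambda>x. x \<noteq> k) z)) \<in> ?P"
      by (simp add: *)
    show "(case (takeWhile (\<lambda>x. x \<noteq> k) z, tl (dropWhile (\<lambda>x. x \<noteq> k) z)) of
        (x, y) \<Rightarrow> x @ k # y) = z"
      "(case (takeWhile (\<lambda>x. x \<noteq> k) z, tl (dropWhile (\<lambda>x. x \<noteq> k) z)) of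
        (x, y) \<Rightarrow> g (x @ k # y)) = g z"
      unfolding * by (simp_all add: z)
  next
    fix p assume "p \<in> ?P"
    moreover obtain x y where p: "p = (x, y)" by (cases p)
    ultimately have xy: "distinct (x @ y)" "set (x @ y) \<subseteq> S - {k}" by auto
    then have "\<forall>v\<in>set x. v \<noteq> k" by auto
    then show "(takeWhile (\<lambda>x. x \<noteq> k) (case p of (x, y) \<Rightarrow> x @ k # y),
        tl (dropWhile (\<lambda>x. x \<noteq> k) (case p of (x, y) \<Rightarrow> x @ k # y))) = p"
      by (simp add: p takeWhile_append2 dropWhile_append2)
    show "(case p of (x, y) \<Rightarrow> x @ k # y) \<in> ?K"
      using xy assms(2) by (auto simp: p dlists_def)
  qed
  also have "\<dots> = (\<Sum>x\<in>dlists (S - {k}). \<Sum>y\<in>dlists (S - {k} - set x). g (x @ k # y))"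
    by (rule sum_dlists_pairs[symmetric]) (use assms(1) in simp)
  finally show ?thesis .
qed

section \<open>The Moore determinant\<close>

fun walk :: "('a \<Rightarrow> 'a \<Rightarrow> quat) \<Rightarrow> 'a list \<Rightarrow> quat" where
  "walk f (x # y # zs) = f x y * walk f (y # zs)"
| "walk f xs = 1"

lemma walk_append: "walk f (xs @ k # ys) = walk f (xs @ [k]) * walk f (k # ys)"
proof (induction xs)
  case (Cons a xs)
  then show ?case by (cases xs) (auto simp: mult.assoc)
qed simp

lemma walk_snoc: "walk f (k # xs @ [l]) = walk f (k # xs) * f (last (k # xs)) l"
  by (induction xs arbitrary: k) (auto simp: mult.assoc)

text \<open>The final position of a walk is only entered, never left, so it reads no row of the
  matrix. This later lets a walk end at an index whose row has been replaced.\<close>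

lemma walk_cong_butlast:
  assumes "\<And>a b. a \<in> set (butlast xs) \<Longrightarrow> b \<in> set xs \<Longrightarrow> f a b = g a b"
  shows "walk f xs = walk g xs"
  using assms by (induction f xs rule: walk.induct) auto

lemma walk_cong:
  assumes "\<And>a b. a \<in> set xs \<Longrightarrow> b \<in> set xs \<Longrightarrow> f a b = g a b"
  shows "walk f xs = walk g xs"
  using assms by (intro walk_cong_butlast) (auto dest: in_set_butlastD)

definition hermitian_on :: "('a \<Rightarrow> 'a \<Rightarrow> quat) \<Rightarrow> 'a set \<Rightarrow> bool" where
  "hermitian_on f S \<longleftrightarrow> (\<forall>a\<in>S. \<forall>b\<in>S. f b a = quat_cnj (f a b))"

lemma hermitian_on_subset: "hermitian_on f S \<Longrightarrow> T \<subseteq> S \<Longrightarrow> hermitian_on f T"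
  unfolding hermitian_on_def by (meson subsetD)

lemma hermitian_onD: "hermitian_on f S \<Longrightarrow> a \<in> S \<Longrightarrow> b \<in> S \<Longrightarrow> f b a = quat_cnj (f a b)"
  unfolding hermitian_on_def by meson

lemma quat_cnj_walk:
  assumes "hermitian_on f (set xs)"
  shows "quat_cnj (walk f xs) = walk f (rev xs)"
  using assms
proof (induction f xs rule: walk.induct)
  case (1 f x y zs)
  have "hermitian_on f (set (y # zs))"
    using 1(2) by (rule hermitian_on_subset) auto
  moreover have "f y x = quat_cnj (f x y)"
    using 1(2) by (rule hermitian_onD) auto
  moreover have "walk f (rev zs @ [y, x]) = walk f (rev zs @ [y]) * f y x"
    by (subst walk_append) simp
  ultimately show ?case using 1(1) by simp
qed auto

text \<open>Reversing a closed walk of a Hermitian matrix conjugates its product, so that sums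
  over closed walks are real.\<close>

lemma sum_closed_walks_real:
  assumes "hermitian_on f (insert k S)" "\<And>x. x \<in> dlists S \<Longrightarrow> c (rev x) = c x"
  shows "(\<Sum>x\<in>dlists S. c x *\<^sub>R walk f (k # x @ [k])) =
    of_real (\<Sum>x\<in>dlists S. c x * qRe (walk f (k # x @ [k])))" (is "?s = of_real ?r")
proof -
  have "?s = (\<Sum>x\<in>dlists S. c (rev x) *\<^sub>R walk f (k # rev x @ [k]))"
    by (rule sum_dlists_rev[symmetric])
  also have "\<dots> = quat_cnj ?s"
    unfolding quat_cnj_sum
  proof (rule sum.cong)
    fix x assume x: "x \<in> dlists S"
    then have "hermitian_on f (set (k # x @ [k]))"
      by (intro hermitian_on_subset[OF assms(1)]) (auto simp: dlists_def)
    from quat_cnj_walk[OF this] show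
      "c (rev x) *\<^sub>R walk f (k # rev x @ [k]) = quat_cnj (c x *\<^sub>R walk f (k # x @ [k]))"
      using assms(2)[OF x] by simp
  qed simp
  finally have "2 *\<^sub>R ?s = of_real (2 * qRe ?s)"
    using quat_add_cnj[of ?s] by (simp add: scaleR_2)
  then have "2 *\<^sub>R ?s = 2 *\<^sub>R of_real (qRe ?s)"
    by (simp add: scaleR_conv_of_real)
  then have "?s = of_real (qRe ?s)"
    unfolding scaleR_cancel_left by simp
  then show ?thesis by (simp add: qRe_sum)
qed

section \<open>The Moore determinant and its expansion along any index\<close>

text \<open>The recursion removes the cycle through the least element; a cycle with
  \<open>length x\<close> further elements has sign \<open>(-1) ^ length x\<close>. Infinite index
  sets get the default value 1.\<close>

function moore_det :: "(nat \<Rightarrow> nat \<Rightarrow> quat) \<Rightarrow> nat set \<Rightarrow> real" where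
  "moore_det f S = (if finite S \<and> S \<noteq> {} then
     \<Sum>x\<in>dlists (S - {Min S}). (-1) ^ length x * qRe (walk f (Min S # x @ [Min S])) *
       moore_det f (S - {Min S} - set x)
   else 1)"
  by pat_completeness auto
termination
proof (relation "measure (\<lambda>(f, S). card S)")
  fix S :: "nat set" and x :: "nat list" and f :: "nat \<Rightarrow> nat \<Rightarrow> quat"
  assume "finite S \<and> S \<noteq> {}"
  then have "finite S" "Min S \<in> S" by simp_all
  then have "card (S - {Min S} - set x) < card S"
    by (intro psubset_card_mono) auto
  then show "((f, S - {Min S} - set x), f, S) \<in> measure (\<lambda>(f, S). card S)"
    by simp
qed simp

declare moore_det.simps [simp del]

lemma moore_det_empty [simp]: "moore_det f {} = 1"
  by (subst moore_det.simps) simp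

lemma moore_det_cong:
  assumes "\<And>a b. a \<in> S \<Longrightarrow> b \<in> S \<Longrightarrow> f a b = g a b"
  shows "moore_det f S = moore_det g S"
proof (cases "finite S")
  case True
  then show ?thesis using assms
  proof (induction S rule: finite_psubset_induct)
    case (psubset S)
    show ?case
    proof (cases "S = {}")
      case False
      with psubset.hyps have m: "Min S \<in> S" by simp
      show ?thesis
        unfolding moore_det.simps[of _ S]
      proof (intro if_cong refl sum.cong arg_cong2[of _ _ _ _ "(*)"])
        fix x assume "x \<in> dlists (S - {Min S})"
        then have x: "set x \<subseteq> S" by (auto simp: dlists_def)
        show "qRe (walk f (Min S # x @ [Min S])) = qRe (walk g (Min S # x @ [Min S]))"
          by (intro arg_cong[of _ _ qRe] walk_cong psubset.prems) (use x m in auto)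
        show "moore_det f (S - {Min S} - set x) = moore_det g (S - {Min S} - set x)"
          by (intro psubset.IH psubset.prems) (use x m in auto)
      qed
    qed simp
  qed
next
  case False
  then show ?thesis by (subst (1 2) moore_det.simps) simp
qed

text \<open>Expanding along \<open>i\<close> and then distinguishing whether a second index
  \<open>j\<close> lies on the same cycle gives an expression symmetric in \<open>i\<close> and
  \<open>j\<close>. Hence every index gives the same value as the least one.\<close>

lemma moore_det_expand:
  assumes "finite S" "i \<in> S"
  shows "moore_det f S = (\<Sum>x\<in>dlists (S - {i}). (-1) ^ length x * qRe (walk f (i # x @ [i])) *
    moore_det f (S - {i} - set x))"
  using assms
proof (induction S arbitrary: i rule: finite_psubset_induct)
  case (psubset S)
  define R where "R i = (\<Sum>x\<in>dlists (S - {i}). (-1) ^ length x * qRe (walk f (i # x @ [i])) *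
    moore_det f (S - {i} - set x))" for i
  \<comment> \<open>If \<open>i\<close> and \<open>j\<close> lie on different cycles, the minor is
    expanded along \<open>j\<close> by induction. If they share a cycle, cutting it at
    \<open>j\<close> yields two open walks; the element \<open>j\<close> itself accounts for the
    minus sign.\<close>
  have two: "R i = (\<Sum>x\<in>dlists (S - {i} - {j}). \<Sum>y\<in>dlists (S - {i} - {j} - set x).
        (-1) ^ (length x + length y) *
        (qRe (walk f (i # x @ [i])) * qRe (walk f (j # y @ [j])) -
          qRe (walk f (i # x @ [j]) * walk f (j # y @ [i]))) *
        moore_det f (S - {i} - {j} - set x - set y))"
    if ij: "i \<in> S" "j \<in> S" "i \<noteq> j" for i j
  proof -
    have fin: "finite (S - {i})" and j: "j \<in> S - {i}"
      using psubset.hyps ij by auto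
    have IH: "moore_det f (S - {i} - set x) =
        (\<Sum>y\<in>dlists (S - {i} - {j} - set x). (-1) ^ length y * qRe (walk f (j # y @ [j])) *
          moore_det f (S - {i} - {j} - set x - set y))"
      if "x \<in> dlists (S - {i} - {j})" for x
    proof -
      have "S - {i} - set x \<subset> S" "j \<in> S - {i} - set x"
        using that ij by (auto simp: dlists_def)
      from psubset.IH[OF this] show ?thesis
        by (simp add: Diff_insert2[symmetric] set_diff_eq conj_ac)
    qed
    have eq: "S - {i} - set (x @ j # y) = S - {i} - {j} - set x - set y" for x y
      by auto
    have app: "walk f (i # (x @ j # y) @ [i]) = walk f (i # x @ [j]) * walk f (j # y @ [i])" for x y
      using walk_append[of f "i # x" j "y @ [i]"] by simp
    have "R i = (\<Sum>x\<in>dlists (S - {i} - {j}). (-1) ^ length x * qRe (walk f (i # x @ [i])) *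
          moore_det f (S - {i} - set x)) +
        (\<Sum>x\<in>dlists (S - {i} - {j}). \<Sum>y\<in>dlists (S - {i} - {j} - set x).
          (-1) ^ length (x @ j # y) * qRe (walk f (i # (x @ j # y) @ [i])) *
          moore_det f (S - {i} - set (x @ j # y)))"
      unfolding R_def by (rule sum_dlists_split[OF fin j])
    also have "(\<Sum>x\<in>dlists (S - {i} - {j}). (-1) ^ length x * qRe (walk f (i # x @ [i])) *
          moore_det f (S - {i} - set x)) =
        (\<Sum>x\<in>dlists (S - {i} - {j}). \<Sum>y\<in>dlists (S - {i} - {j} - set x).
        (-1) ^ (length x + length y) *
        (qRe (walk f (i # x @ [i])) * qRe (walk f (j # y @ [j]))) *
        moore_det f (S - {i} - {j} - set x - set y))"
      by (intro sum.cong refl) (simp add: IH sum_distrib_left power_add mult_ac)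
    finally show ?thesis
      unfolding app eq sum.distrib[symmetric]
      by (rule trans) (intro sum.cong refl, simp add: algebra_simps)
  qed
  have "R i = R j" if ij: "i \<in> S" "j \<in> S" for i j
  proof (cases "i = j")
    case False
    have eq: "S - {j} - {i} = S - {i} - {j}" by auto
    have eq': "S - {i} - {j} - set y - set x = S - {i} - {j} - set x - set y" for x y by auto
    \<comment> \<open>Cyclicity of the real part makes it immaterial which arc of a shared cycle
      comes first.\<close>
    have sym: "qRe (walk f (i # y @ [i])) * qRe (walk f (j # x @ [j])) -
          qRe (walk f (i # y @ [j]) * walk f (j # x @ [i])) =
        qRe (walk f (j # x @ [j])) * qRe (walk f (i # y @ [i])) -
          qRe (walk f (j # x @ [i]) * walk f (i # y @ [j]))" for x y
      by (metis mult.commute qRe_mult_commute)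
    have fin: "finite (S - {i} - {j})"
      using psubset.hyps by simp
    show ?thesis
      unfolding two[OF ij False] two[OF ij(2,1) False[symmetric]] eq
      by (subst sum_dlists_swap[OF fin]) (simp only: eq' sym add.commute)
  qed simp
  moreover have "moore_det f S = R (Min S)" "Min S \<in> S"
    using psubset.hyps psubset.prems by (auto simp: moore_det.simps[of f S] R_def intro!: Min_in)
  ultimately have "moore_det f S = R i"
    using psubset.prems by metis
  then show ?case
    by (simp only: R_def)
qed

text \<open>The weights depend only on the set of elements of \<open>x\<close>, so they are
  invariant under reversal. The quaternionic sum is therefore already real and agrees with the sum
  of real parts.\<close>

lemma moore_det_expand_quat:
  assumes "finite S" "i \<in> S" "hermitian_on f S"
  shows "(\<Sum>x\<in>dlists (S - {i}). ((-1) ^ length x * moore_det f (S - {i} - set x)) *\<^sub>R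
    walk f (i # x @ [i])) = of_real (moore_det f S)"
proof -
  have "hermitian_on f (insert i (S - {i}))"
    using assms by (simp add: insert_absorb)
  then show ?thesis
    by (subst sum_closed_walks_real) (simp_all add: moore_det_expand[OF assms(1,2), of f] mult_ac)
qed

text \<open>Split the lists \<open>x\<close> according to whether \<open>k\<close> occurs in them, expanding
  the complementary minor along \<open>k\<close> if it does not. Both parts then consist of a closed walk
  through \<open>k\<close> and an open walk starting at \<open>k\<close>, with opposite signs.\<close>

lemma sum_open_walks_eq_0:
  assumes "finite S" "k \<in> S" "hermitian_on f S"
  shows "(\<Sum>x\<in>dlists S. ((-1) ^ length x * moore_det f (S - set x)) *\<^sub>R
    (walk f (k # x) * e (last (k # x)))) = 0"
proof -
  define U where "U = S - {k}"
  have fin: "finite U" using assms by (simp add: U_def)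
  define A where "A x = walk f (k # x) * e (last (k # x))" for x
  define C where "C x = walk f (k # x @ [k])" for x
  have exp: "moore_det f (S - set x) = (\<Sum>y\<in>dlists (U - set x). (-1) ^ length y * qRe (C y) *
      moore_det f (U - set x - set y))" if "x \<in> dlists U" for x
  proof -
    have "finite (S - set x)" "k \<in> S - set x" "S - set x - {k} = U - set x"
      using that assms by (auto simp: dlists_def U_def)
    then show ?thesis using moore_det_expand[of "S - set x" k f] by (simp add: C_def)
  qed
  have app: "A (x @ k # y) = C x * A y" for x y
    using walk_append[of f "k # x" k y] by (simp add: A_def C_def mult.assoc)
  have "(\<Sum>x\<in>dlists S. ((-1) ^ length x * moore_det f (S - set x)) *\<^sub>R A x) =
      (\<Sum>x\<in>dlists U. ((-1) ^ length x * moore_det f (S - set x)) *\<^sub>R A x) +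
      (\<Sum>x\<in>dlists U. \<Sum>y\<in>dlists (U - set x).
        ((-1) ^ length (x @ k # y) * moore_det f (S - set (x @ k # y))) *\<^sub>R A (x @ k # y))"
    unfolding U_def by (rule sum_dlists_split[OF assms(1,2)])
  also have "(\<Sum>x\<in>dlists U. ((-1) ^ length x * moore_det f (S - set x)) *\<^sub>R A x) =
      (\<Sum>x\<in>dlists U. \<Sum>y\<in>dlists (U - set x).
        ((-1) ^ (length x + length y) * moore_det f (U - set x - set y) * qRe (C y)) *\<^sub>R A x)"
    by (intro sum.cong refl) (simp add: exp sum_distrib_left scaleR_sum_left power_add mult_ac)
  also have "(\<Sum>x\<in>dlists U. \<Sum>y\<in>dlists (U - set x).
        ((-1) ^ length (x @ k # y) * moore_det f (S - set (x @ k # y))) *\<^sub>R A (x @ k # y)) =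
      (\<Sum>x\<in>dlists U. \<Sum>y\<in>dlists (U - set x).
        - (((-1) ^ (length x + length y) * moore_det f (U - set x - set y)) *\<^sub>R (C x * A y)))"
  proof -
    have "S - set (x @ k # y) = U - set x - set y" for x y by (auto simp: U_def)
    then show ?thesis by (simp add: app)
  qed
  \<comment> \<open>The two lists exchange roles, so that \<open>x\<close> carries the open walk
    here as it does in the first double sum.\<close>
  also have "\<dots> = (\<Sum>x\<in>dlists U. \<Sum>y\<in>dlists (U - set x).
        - (((-1) ^ (length x + length y) * moore_det f (U - set x - set y)) *\<^sub>R (C y * A x)))"
  proof -
    have "U - set x - set y = U - set y - set x" for x y by auto
    then show ?thesis by (subst sum_dlists_swap[OF fin]) (simp add: add.commute)
  qed
  also have "\<dots> = (\<Sum>x\<in>dlists U. - (\<Sum>y\<in>dlists (U - set x).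
        ((-1) ^ (length x + length y) * moore_det f (U - set x - set y) * qRe (C y)) *\<^sub>R A x))"
  proof (rule sum.cong[OF refl])
    fix x
    let ?c = "\<lambda>y. (-1) ^ (length x + length y) * moore_det f (U - set x - set y)"
    have "(\<Sum>y\<in>dlists (U - set x). - (?c y *\<^sub>R (C y * A x))) =
        - ((\<Sum>y\<in>dlists (U - set x). ?c y *\<^sub>R C y) * A x)"
      by (simp add: sum_negf sum_distrib_right)
    \<comment> \<open>For fixed \<open>x\<close> the closed walks run over all lists in the
      remaining set, with reversal-invariant weights, so their sum is real.\<close>
    also have "(\<Sum>y\<in>dlists (U - set x). ?c y *\<^sub>R C y) =
        of_real (\<Sum>y\<in>dlists (U - set x). ?c y * qRe (C y))"
      unfolding C_def
      by (rule sum_closed_walks_real) (use assms in \<open>auto simp: U_def intro: hermitian_on_subset\<close>)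
    finally show "(\<Sum>y\<in>dlists (U - set x). - (?c y *\<^sub>R (C y * A x))) =
        - (\<Sum>y\<in>dlists (U - set x). (?c y * qRe (C y)) *\<^sub>R A x)"
      by (simp add: scaleR_conv_of_real sum_distrib_right)
  qed
  finally show ?thesis
    by (simp add: A_def sum_negf)
qed

section \<open>Transvections and Schur complements\<close>

text \<open>Here \<open>g\<close> is \<open>E f E*\<close>, where \<open>E\<close> adds to row
  \<open>k\<close> the left combination of the rows in \<open>P\<close> with coefficients
  \<open>c\<close>. Expanding along \<open>k\<close> gives a double sum over the start and the end
  of the walk, in which the vanishing of open walks kills all terms except the one from
  \<open>k\<close> to \<open>k\<close>.\<close>

lemma moore_det_transvection:
  assumes fin: "finite S" and k: "k \<notin> S" and P: "P \<subseteq> S"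
    and f: "hermitian_on f (insert k S)" and g: "hermitian_on g (insert k S)"
    and gf: "\<And>a b. a \<in> S \<Longrightarrow> b \<in> S \<Longrightarrow> g a b = f a b"
    and gk: "\<And>b. b \<in> S \<Longrightarrow> g k b = f k b + (\<Sum>p\<in>P. c p * f p b)"
    and gkk: "g k k = f k k + (\<Sum>p\<in>P. c p * f p k) + (\<Sum>p\<in>P. f k p * quat_cnj (c p)) +
      (\<Sum>p\<in>P. \<Sum>q\<in>P. c p * f p q * quat_cnj (c q))"
  shows "moore_det g (insert k S) = moore_det f (insert k S)"
proof -
  \<comment> \<open>Giving \<open>k\<close> the coefficient 1 merges the old row and the added
    multiples into a single sum over \<open>P'\<close>.\<close>
  define d where "d = c(k := 1)"
  define P' where "P' = insert k P"
  have finP: "finite P" and kP: "k \<notin> P"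
    using fin k P by (auto intro: finite_subset)
  have sum_P': "(\<Sum>p\<in>P'. u p) = u k + (\<Sum>p\<in>P. u p)" for u :: "nat \<Rightarrow> quat"
    using finP kP by (simp add: P'_def)
  have P'S: "P' \<subseteq> insert k S" using P by (auto simp: P'_def)
  have dk: "d k = 1" and dP: "\<And>p. p \<in> P \<Longrightarrow> d p = c p"
    using kP by (auto simp: d_def)
  have row: "g k b = (\<Sum>p\<in>P'. d p * f p b)" if "b \<in> S" for b
    using gk[OF that] by (simp add: sum_P' dk dP)
  have col: "g b k = (\<Sum>q\<in>P'. f b q * quat_cnj (d q))" if "b \<in> S" for b
  proof -
    have "g b k = quat_cnj (g k b)"
      using that by (intro hermitian_onD[OF g]) auto
    also have "\<dots> = (\<Sum>q\<in>P'. quat_cnj (f q b) * quat_cnj (d q))"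
      by (simp add: row[OF that] quat_cnj_sum)
    also have "\<dots> = (\<Sum>q\<in>P'. f b q * quat_cnj (d q))"
    proof (rule sum.cong[OF refl])
      fix q assume "q \<in> P'"
      then have "f b q = quat_cnj (f q b)"
        using that P'S by (intro hermitian_onD[OF f]) auto
      then show "quat_cnj (f q b) * quat_cnj (d q) = f b q * quat_cnj (d q)"
        by metis
    qed
    finally show ?thesis .
  qed
  have corner: "g k k = (\<Sum>p\<in>P'. \<Sum>q\<in>P'. d p * f p q * quat_cnj (d q))"
    by (simp add: gkk sum_P' dk dP sum.distrib add.assoc add.commute add.left_commute)
  have walk_g: "walk g (k # x @ [k]) =
      (\<Sum>p\<in>P'. \<Sum>q\<in>P'. d p * walk f (p # x @ [q]) * quat_cnj (d q))" if "x \<in> dlists S" for x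
  proof (cases x)
    case Nil
    then show ?thesis by (simp add: corner)
  next
    case (Cons a y)
    with that have a: "a \<in> S" and l: "last (a # y) \<in> S" and ay: "set (a # y) \<subseteq> S"
      by (auto simp: dlists_def)
    have eq: "walk g (a # y) = walk f (a # y)"
      by (intro walk_cong gf) (use ay in auto)
    have "walk g (k # x @ [k]) = g k a * (walk f (a # y) * g (last (a # y)) k)"
      using walk_snoc[of g a y k] eq by (simp add: Cons)
    also have "\<dots> = (\<Sum>p\<in>P'. \<Sum>q\<in>P'. d p * (f p a * (walk f (a # y) * f (last (a # y)) q)) *
        quat_cnj (d q))"
      by (simp only: row[OF a] col[OF l] sum_distrib_left sum_distrib_right mult.assoc)
        (rule sum.swap)
    also have "\<dots> = (\<Sum>p\<in>P'. \<Sum>q\<in>P'. d p * walk f (p # x @ [q]) * quat_cnj (d q))"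
      using walk_snoc[of f a y] by (simp add: Cons)
    finally show ?thesis .
  qed
  \<comment> \<open>The expansion along \<open>k\<close> with the two ends of the closed walk
    replaced by \<open>p\<close> and \<open>q\<close>; only \<open>T k k\<close> is a
    determinant.\<close>
  define T where "T p q = (\<Sum>x\<in>dlists S. ((-1) ^ length x * moore_det f (S - set x)) *\<^sub>R
    walk f (p # x @ [q]))" for p q
  have T0: "T p q = 0" if "p \<in> S" for p q
    using sum_open_walks_eq_0[OF fin that hermitian_on_subset[OF f], of "\<lambda>z. f z q"]
    unfolding T_def walk_snoc by auto
  \<comment> \<open>Vanishing is known for walks starting in \<open>S\<close>; reversal and
    conjugation carry it over to walks ending in \<open>S\<close>.\<close>
  have T0': "T k q = 0" if q: "q \<in> S" for q
  proof -
    have "T k q = (\<Sum>x\<in>dlists S. ((-1) ^ length (rev x) * moore_det f (S - set (rev x))) *\<^sub>R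
        walk f (k # rev x @ [q]))"
      unfolding T_def by (rule sum_dlists_rev[symmetric])
    also have "\<dots> = quat_cnj (T q k)"
      unfolding T_def quat_cnj_sum
    proof (rule sum.cong[OF refl])
      fix x assume "x \<in> dlists S"
      then have "hermitian_on f (set (q # x @ [k]))"
        using q by (intro hermitian_on_subset[OF f]) (auto simp: dlists_def)
      from quat_cnj_walk[OF this]
      show "((-1) ^ length (rev x) * moore_det f (S - set (rev x))) *\<^sub>R walk f (k # rev x @ [q]) =
          quat_cnj (((-1) ^ length x * moore_det f (S - set x)) *\<^sub>R walk f (q # x @ [k]))"
        by simp
    qed
    finally show ?thesis using T0[OF q] by simp
  qed
  have Skk: "insert k S - {k} = S" using k by auto
  have Tkk: "T k k = of_real (moore_det f (insert k S))"
    using moore_det_expand_quat[of "insert k S" k f] fin f by (simp add: Skk T_def)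
  have "of_real (moore_det g (insert k S)) = (\<Sum>x\<in>dlists S.
      ((-1) ^ length x * moore_det g (S - set x)) *\<^sub>R walk g (k # x @ [k]))"
    using moore_det_expand_quat[of "insert k S" k g] fin g by (simp add: Skk)
  also have "\<dots> = (\<Sum>x\<in>dlists S. \<Sum>p\<in>P'. \<Sum>q\<in>P'. d p *
      (((-1) ^ length x * moore_det f (S - set x)) *\<^sub>R walk f (p # x @ [q])) * quat_cnj (d q))"
  proof (rule sum.cong[OF refl])
    fix x assume "x \<in> dlists S"
    moreover have "moore_det g (S - set x) = moore_det f (S - set x)"
      by (intro moore_det_cong gf) auto
    ultimately show "((-1) ^ length x * moore_det g (S - set x)) *\<^sub>R walk g (k # x @ [k]) =
        (\<Sum>p\<in>P'. \<Sum>q\<in>P'. d p *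
          (((-1) ^ length x * moore_det f (S - set x)) *\<^sub>R walk f (p # x @ [q])) * quat_cnj (d q))"
      by (simp add: walk_g scaleR_sum_right)
  qed
  also have "\<dots> = (\<Sum>p\<in>P'. \<Sum>q\<in>P'. d p * T p q * quat_cnj (d q))"
    unfolding T_def sum_distrib_left sum_distrib_right
    by (subst sum.swap, intro sum.cong refl, subst sum.swap) (rule refl)
  also have "\<dots> = T k k"
  proof -
    have "(\<Sum>p\<in>P. \<Sum>q\<in>P'. d p * T p q * quat_cnj (d q)) = 0"
      using P T0 by (intro sum.neutral ballI) auto
    moreover have "(\<Sum>q\<in>P. d k * T k q * quat_cnj (d q)) = 0"
      using P T0' by (intro sum.neutral ballI) auto
    ultimately show ?thesis
      unfolding sum_P'[of "\<lambda>p. \<Sum>q\<in>P'. d p * T p q * quat_cnj (d q)"]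
        sum_P'[of "\<lambda>q. d k * T k q * quat_cnj (d q)"] by (simp add: dk)
  qed
  finally show ?thesis
    by (simp add: Tkk)
qed

text \<open>Any cycle that leaves \<open>i\<close> for \<open>S\<close> contains a zero factor, so
  only the fixed point \<open>i\<close> contributes.\<close>

lemma moore_det_insert_unit:
  assumes "finite S" "i \<notin> S" "f i i = 1" "\<And>b. b \<in> S \<Longrightarrow> f i b = 0"
  shows "moore_det f (insert i S) = moore_det f S"
proof -
  have S: "insert i S - {i} = S" using assms by auto
  have "moore_det f (insert i S) = (\<Sum>x\<in>dlists S. (-1) ^ length x * qRe (walk f (i # x @ [i])) *
      moore_det f (S - set x))"
    using moore_det_expand[of "insert i S" i f] assms(1) by (simp add: S)
  also have "\<dots> = (\<Sum>x\<in>{[]}. (-1) ^ length x * qRe (walk f (i # x @ [i])) *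
      moore_det f (S - set x))"
  proof (rule sum.mono_neutral_right)
    show "\<forall>x\<in>dlists S - {[]}. (-1) ^ length x * qRe (walk f (i # x @ [i])) *
      moore_det f (S - set x) = 0"
    proof
      fix x assume "x \<in> dlists S - {[]}"
      then obtain a y where "x = a # y" "a \<in> S"
        by (cases x) (auto simp: dlists_def)
      then show "(-1) ^ length x * qRe (walk f (i # x @ [i])) * moore_det f (S - set x) = 0"
        using assms(4) by simp
    qed
  qed (use assms in \<open>auto simp: dlists_def[of S] finite_dlists[unfolded dlists_def]\<close>)
  finally show ?thesis using assms(3) by simp
qed

lemma moore_det_Un_unit:
  assumes "finite P" "finite Q" "P \<inter> Q = {}"
    "\<And>p q. p \<in> P \<Longrightarrow> q \<in> P \<Longrightarrow> f p q = (if p = q then 1 else 0)"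
    "\<And>p q. p \<in> P \<Longrightarrow> q \<in> Q \<Longrightarrow> f p q = 0"
  shows "moore_det f (P \<union> Q) = moore_det f Q"
  using assms
proof (induction P rule: finite_induct)
  case (insert i P)
  have "moore_det f (insert i (P \<union> Q)) = moore_det f (P \<union> Q)"
    using insert.hyps insert.prems by (intro moore_det_insert_unit) auto
  also have "\<dots> = moore_det f Q"
    using insert.prems by (intro insert.IH) auto
  finally show ?case by simp
qed simp

text \<open>The rows indexed by \<open>Q\<close> are cleared one at a time; \<open>h R\<close> is the matrix in which the rows
  and columns indexed by \<open>R\<close> have been cleared.\<close>

lemma moore_det_schur:
  assumes "finite P" "finite Q" "P \<inter> Q = {}" "hermitian_on f (P \<union> Q)"
    and unit: "\<And>p q. p \<in> P \<Longrightarrow> q \<in> P \<Longrightarrow> f p q = (if p = q then 1 else 0)"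
  shows "moore_det f (P \<union> Q) = moore_det (\<lambda>a b. f a b - (\<Sum>p\<in>P. f a p * f p b)) Q"
proof -
  define s where "s a b = (\<Sum>p\<in>P. f a p * f p b)" for a b
  define h where "h R a b = (if a \<in> R \<or> b \<in> R then (if a \<in> Q \<and> b \<in> Q then f a b - s a b else 0)
    else f a b)" for R a b
  have herm: "f b a = quat_cnj (f a b)" if "a \<in> P \<union> Q" "b \<in> P \<union> Q" for a b
    using hermitian_onD[OF assms(4)] that by metis
  have cnj_s: "quat_cnj (s a b) = s b a" if "a \<in> P \<union> Q" "b \<in> P \<union> Q" for a b
    unfolding s_def quat_cnj_sum quat_cnj_mult
    using that by (intro sum.cong refl arg_cong2[of _ _ _ _ "(*)"]) (auto simp: herm[symmetric])
  have herm_h: "hermitian_on (h R) (P \<union> Q)" if "R \<subseteq> Q" for R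
    unfolding hermitian_on_def
  proof (intro ballI)
    fix a b assume ab: "a \<in> P \<union> Q" "b \<in> P \<union> Q"
    have "quat_cnj (f a b) = f b a" "quat_cnj (s a b) = s b a"
      using herm[OF ab] cnj_s[OF ab] by metis+
    then show "h R b a = quat_cnj (h R a b)"
      by (simp add: h_def conj_commute disj_commute)
  qed
  have "moore_det (h R) (P \<union> Q) = moore_det f (P \<union> Q)" if "R \<subseteq> Q" for R
    using finite_subset[OF that assms(2)] that
  proof (induction R rule: finite_induct)
    case empty
    have "h {} = f" by (simp add: h_def fun_eq_iff)
    then show ?case by simp
  next
    case (insert k R)
    define S where "S = P \<union> Q - {k}"
    have kQ: "k \<in> Q" "k \<notin> P" "k \<notin> R" "R \<subseteq> Q"
      using insert assms(3) by auto
    have PQ: "P \<union> Q = insert k S" using kQ by (auto simp: S_def)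
    have PR: "p \<notin> R" "p \<notin> Q" "p \<noteq> k" if "p \<in> P" for p
      using that kQ assms(3) by auto
    have unit_sum: "(\<Sum>p\<in>P. f k p * f p q) = f k q" if "q \<in> P" for q
    proof -
      have "(\<Sum>p\<in>P. f k p * f p q) = (\<Sum>p\<in>P. if p = q then f k p else 0)"
        using that by (intro sum.cong refl) (simp add: unit)
      also have "\<dots> = f k q"
        using that assms(1) by (simp add: sum.delta)
      finally show ?thesis .
    qed
    have "moore_det (h (insert k R)) (insert k S) = moore_det (h R) (insert k S)"
    proof (rule moore_det_transvection[where P = P and c = "\<lambda>p. - f k p"])
      show "finite S" "k \<notin> S" using assms by (auto simp: S_def)
      show "P \<subseteq> S" using kQ by (auto simp: S_def)
      show "hermitian_on (h R) (insert k S)" "hermitian_on (h (insert k R)) (insert k S)"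
        using herm_h[of R] herm_h[of "insert k R"] kQ by (simp_all add: PQ)
      show "h (insert k R) a b = h R a b" if "a \<in> S" "b \<in> S" for a b
        using that by (simp add: h_def S_def)
      \<comment> \<open>For \<open>b\<close> in \<open>P\<close> the unit block makes the entry
        cancel. For \<open>b\<close> in \<open>R\<close> the entries in rows of \<open>P\<close> are
        already zero and nothing changes. Otherwise the entry receives the correction
        \<open>- s k b\<close>.\<close>
      show "h (insert k R) k b = h R k b + (\<Sum>p\<in>P. - f k p * h R p b)" if b: "b \<in> S" for b
      proof -
        consider "b \<in> P" | "b \<in> Q" "b \<in> R" | "b \<in> Q" "b \<notin> R"
          using b by (auto simp: S_def)
        then show ?thesis
        proof cases
          case 1
          then have "(\<Sum>p\<in>P. - f k p * h R p b) = - f k b"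
            by (simp add: h_def PR sum_negf unit_sum)
          then show ?thesis using 1 kQ by (simp add: h_def PR)
        next
          case 2
          then show ?thesis using kQ by (simp add: h_def PR)
        next
          case 3
          then have "(\<Sum>p\<in>P. - f k p * h R p b) = - s k b"
            by (simp add: h_def PR sum_negf s_def)
          then show ?thesis using 3 kQ by (simp add: h_def)
        qed
      qed
      \<comment> \<open>The row operation and the column operation each contribute
        \<open>- s k k\<close>, and their combined effect contributes \<open>s k k\<close>, which
        leaves \<open>f k k - s k k\<close>.\<close>
      show "h (insert k R) k k = h R k k + (\<Sum>p\<in>P. - f k p * h R p k) +
          (\<Sum>p\<in>P. h R k p * quat_cnj (- f k p)) +
          (\<Sum>p\<in>P. \<Sum>q\<in>P. - f k p * h R p q * quat_cnj (- f k q))"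
      proof -
        have cnj: "quat_cnj (f k p) = f p k" if "p \<in> P" for p
          using herm[of k p] that kQ by simp
        have "(\<Sum>p\<in>P. - f k p * h R p k) = - s k k"
          using kQ by (simp add: h_def PR sum_negf s_def)
        moreover have "(\<Sum>p\<in>P. h R k p * quat_cnj (- f k p)) = - s k k"
          using kQ by (simp add: h_def PR sum_negf s_def cnj)
        moreover have "(\<Sum>p\<in>P. \<Sum>q\<in>P. - f k p * h R p q * quat_cnj (- f k q)) = s k k"
        proof -
          have "(\<Sum>p\<in>P. \<Sum>q\<in>P. - f k p * h R p q * quat_cnj (- f k q)) =
              (\<Sum>q\<in>P. \<Sum>p\<in>P. f k p * f p q * f q k)"
            by (subst sum.swap) (simp add: h_def PR cnj)
          also have "\<dots> = s k k"
            unfolding sum_distrib_right[symmetric] s_def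
            by (intro sum.cong refl) (simp add: unit_sum)
          finally show ?thesis .
        qed
        ultimately show ?thesis using kQ by (simp add: h_def)
      qed
    qed
    with insert.IH kQ show ?case by (simp add: PQ)
  qed
  from this[of Q] have "moore_det f (P \<union> Q) = moore_det (h Q) (P \<union> Q)"
    by simp
  also have "\<dots> = moore_det (h Q) Q"
    using assms(1-3) unit by (intro moore_det_Un_unit) (auto simp: h_def)
  also have "\<dots> = moore_det (\<lambda>a b. f a b - s a b) Q"
    by (intro moore_det_cong) (simp add: h_def)
  finally show ?thesis by (simp only: s_def)
qed

section \<open>Scaling, reindexing and continuity\<close>

lemma walk_scaleR:
  "walk (\<lambda>a b. r *\<^sub>R f a b) (k # xs) = r ^ length xs *\<^sub>R walk f (k # xs)"
  by (induction xs arbitrary: k) simp_all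

lemma moore_det_scaleR:
  assumes "finite S"
  shows "moore_det (\<lambda>a b. r *\<^sub>R f a b) S = r ^ card S * moore_det f S"
  using assms
proof (induction S rule: finite_psubset_induct)
  case (psubset S)
  show ?case
  proof (cases "S = {}")
    case False
    then obtain i where i: "i \<in> S" by auto
    show ?thesis
      unfolding moore_det_expand[OF psubset.hyps i, of f] sum_distrib_left
        moore_det_expand[OF psubset.hyps i, of "\<lambda>a b. r *\<^sub>R f a b"]
    proof (rule sum.cong[OF refl])
      fix x assume x: "x \<in> dlists (S - {i})"
      then have "length x = card (set x)" "set x \<subseteq> S - {i}"
        by (auto simp: dlists_def distinct_card)
      \<comment> \<open>The closed walk has \<open>Suc (length x)\<close> factors, one for each
        index it uses up.\<close>
      then have card: "card S = Suc (length x) + card (S - {i} - set x)"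
        using psubset.hyps i card_Suc_Diff1[OF psubset.hyps i]
          card_mono[of "S - {i}" "set x"] by (simp add: card_Diff_subset)
      have "moore_det (\<lambda>a b. r *\<^sub>R f a b) (S - {i} - set x) =
          r ^ card (S - {i} - set x) * moore_det f (S - {i} - set x)"
        using i by (intro psubset.IH) auto
      then show "(-1) ^ length x * qRe (walk (\<lambda>a b. r *\<^sub>R f a b) (i # x @ [i])) *
            moore_det (\<lambda>a b. r *\<^sub>R f a b) (S - {i} - set x) =
          r ^ card S * ((-1) ^ length x * qRe (walk f (i # x @ [i])) *
            moore_det f (S - {i} - set x))"
        unfolding card walk_scaleR by (simp add: power_add)
    qed
  qed simp
qed

lemma walk_map: "walk f (map \<phi> xs) = walk (\<lambda>a b. f (\<phi> a) (\<phi> b)) xs"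
  by (induction xs rule: induct_list012) simp_all

text \<open>Since \<open>\<phi>\<close> need not be monotone, it may not preserve the least element
  on which the recursion is based; expansion along an arbitrary index avoids this.\<close>

lemma moore_det_image:
  assumes "finite S" "inj_on \<phi> S"
  shows "moore_det f (\<phi> ` S) = moore_det (\<lambda>a b. f (\<phi> a) (\<phi> b)) S"
  using assms
proof (induction S rule: finite_psubset_induct)
  case (psubset S)
  show ?case
  proof (cases "S = {}")
    case False
    then obtain i where i: "i \<in> S" by auto
    have inj: "inj_on \<phi> (S - {i})"
      using psubset.prems by (rule inj_on_subset) auto
    have dl: "dlists (\<phi> ` S - {\<phi> i}) = map \<phi> ` dlists (S - {i})"
    proof (intro equalityI subsetI)
      fix y assume y: "y \<in> dlists (\<phi> ` S - {\<phi> i})"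
      define x where "x = map (inv_into S \<phi>) y"
      have "map \<phi> x = y"
        unfolding x_def map_map using y
        by (intro map_idI) (auto simp: dlists_def f_inv_into_f)
      moreover from this have "distinct x"
        using y by (metis (no_types, lifting) dlists_def distinct_map mem_Collect_eq)
      moreover have "set x \<subseteq> S - {i}"
      proof
        fix v assume "v \<in> set x"
        then obtain w where w: "w \<in> set y" "v = inv_into S \<phi> w" by (auto simp: x_def)
        then have "w \<in> \<phi> ` S" "w \<noteq> \<phi> i" using y by (auto simp: dlists_def)
        then show "v \<in> S - {i}" using w by (auto simp: inv_into_into f_inv_into_f)
      qed
      ultimately show "y \<in> map \<phi> ` dlists (S - {i})"
        by (auto simp: dlists_def)
    next
      fix y assume "y \<in> map \<phi> ` dlists (S - {i})"
      then obtain x where x: "y = map \<phi> x" "distinct x" "set x \<subseteq> S - {i}"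
        by (auto simp: dlists_def)
      then have "distinct y" "set y \<subseteq> \<phi> ` (S - {i})"
        using inj_on_subset[OF inj x(3)] by (auto simp: distinct_map)
      moreover have "\<phi> ` (S - {i}) = \<phi> ` S - {\<phi> i}"
        using psubset.prems i by (auto simp: inj_on_def)
      ultimately show "y \<in> dlists (\<phi> ` S - {\<phi> i})"
        by (auto simp: dlists_def)
    qed
    have inj_map: "inj_on (map \<phi>) (dlists (S - {i}))"
      using inj by (intro inj_on_mapI inj_on_subset[OF inj]) (auto simp: dlists_def)
    have "moore_det f (\<phi> ` S) = (\<Sum>y\<in>dlists (\<phi> ` S - {\<phi> i}). (-1) ^ length y *
        qRe (walk f (\<phi> i # y @ [\<phi> i])) * moore_det f (\<phi> ` S - {\<phi> i} - set y))"
      using psubset.hyps i by (intro moore_det_expand) auto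
    also have "\<dots> = (\<Sum>x\<in>dlists (S - {i}). (-1) ^ length (map \<phi> x) *
        qRe (walk f (\<phi> i # map \<phi> x @ [\<phi> i])) * moore_det f (\<phi> ` S - {\<phi> i} - set (map \<phi> x)))"
      unfolding dl by (subst sum.reindex[OF inj_map]) simp
    also have "\<dots> = (\<Sum>x\<in>dlists (S - {i}). (-1) ^ length x *
        qRe (walk (\<lambda>a b. f (\<phi> a) (\<phi> b)) (i # x @ [i])) *
        moore_det (\<lambda>a b. f (\<phi> a) (\<phi> b)) (S - {i} - set x))"
    proof (rule sum.cong[OF refl])
      fix x assume "x \<in> dlists (S - {i})"
      then have x: "set x \<subseteq> S - {i}" by (auto simp: dlists_def)
      have "\<phi> ` S - {\<phi> i} - set (map \<phi> x) = \<phi> ` (S - {i} - set x)"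
        using psubset.prems i x by (auto simp: inj_on_def)
      moreover have "moore_det f (\<phi> ` (S - {i} - set x)) =
          moore_det (\<lambda>a b. f (\<phi> a) (\<phi> b)) (S - {i} - set x)"
        using i by (intro psubset.IH inj_on_subset[OF psubset.prems]) auto
      ultimately show "(-1) ^ length (map \<phi> x) *
          qRe (walk f (\<phi> i # map \<phi> x @ [\<phi> i])) * moore_det f (\<phi> ` S - {\<phi> i} - set (map \<phi> x)) =
          (-1) ^ length x * qRe (walk (\<lambda>a b. f (\<phi> a) (\<phi> b)) (i # x @ [i])) *
          moore_det (\<lambda>a b. f (\<phi> a) (\<phi> b)) (S - {i} - set x)"
        using walk_map[of f \<phi> "i # x @ [i]"] by simp
    qed
    also have "\<dots> = moore_det (\<lambda>a b. f (\<phi> a) (\<phi> b)) S"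
      by (rule moore_det_expand[OF psubset.hyps i, symmetric])
    finally show ?thesis .
  qed simp
qed

text \<open>Quaternions carry only their algebraic structure here, so continuity in a real parameter
  is imposed on the four coordinates.\<close>

definition quat_continuous :: "(real \<Rightarrow> quat) \<Rightarrow> bool" where
  "quat_continuous h \<longleftrightarrow> continuous_on UNIV (\<lambda>t. qRe (h t)) \<and> continuous_on UNIV (\<lambda>t. qI (h t)) \<and>
     continuous_on UNIV (\<lambda>t. qJ (h t)) \<and> continuous_on UNIV (\<lambda>t. qK (h t))"

lemma quat_continuous_const: "quat_continuous (\<lambda>t. c)"
  by (simp add: quat_continuous_def)

lemma quat_continuous_of_real: "quat_continuous (\<lambda>t. of_real t)"
  by (auto simp: quat_continuous_def of_real_def scaleR_quat_def one_quat_def intro!: continuous_intros)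

lemma quat_continuous_diff:
  "quat_continuous g \<Longrightarrow> quat_continuous h \<Longrightarrow> quat_continuous (\<lambda>t. g t - h t)"
  by (auto simp: quat_continuous_def minus_quat_def intro!: continuous_intros)

lemma quat_continuous_mult:
  "quat_continuous g \<Longrightarrow> quat_continuous h \<Longrightarrow> quat_continuous (\<lambda>t. g t * h t)"
  by (auto simp: quat_continuous_def times_quat_def intro!: continuous_intros)

text \<open>For finite \<open>S\<close> the determinant is a polynomial in the real coordinates of
  the entries.\<close>

lemma continuous_on_moore_det:
  assumes "\<And>a b. quat_continuous (\<lambda>t. F t a b)"
  shows "continuous_on UNIV (\<lambda>t. moore_det (F t) S)"
proof (cases "finite S")
  case True
  have walk: "quat_continuous (\<lambda>t. walk (F t) xs)" for xs
    by (induction xs rule: induct_list012)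
      (auto intro!: quat_continuous_const quat_continuous_mult assms)
  show ?thesis using True
  proof (induction S rule: finite_psubset_induct)
    case (psubset S)
    show ?case
    proof (cases "S = {}")
      case False
      then obtain i where i: "i \<in> S" by auto
      show ?thesis
        unfolding moore_det_expand[OF psubset.hyps i]
      proof (intro continuous_on_sum continuous_on_mult continuous_on_const)
        fix x
        show "continuous_on UNIV (\<lambda>t. qRe (walk (F t) (i # x @ [i])))"
          using walk by (simp add: quat_continuous_def)
        show "continuous_on UNIV (\<lambda>t. moore_det (F t) (S - {i} - set x))"
          using i by (intro psubset.IH) auto
      qed
    qed simp
  qed
qed (simp add: moore_det.simps[of _ S])

section \<open>Equality of the two Gram determinants\<close>

lemma moore_det_gram:
  fixes A :: "nat \<Rightarrow> nat \<Rightarrow> quat"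
  shows "moore_det (\<lambda>a b. \<Sum>p<n. quat_cnj (A p a) * A p b) {..<n} =
    moore_det (\<lambda>a b. \<Sum>p<n. A a p * quat_cnj (A b p)) {..<n}"
proof -
  define \<delta> :: "nat \<Rightarrow> nat \<Rightarrow> quat" where "\<delta> a b = (if a = b then 1 else 0)" for a b
  define M where "M a b = (\<Sum>p<n. quat_cnj (A p a) * A p b)" for a b
  define N where "N a b = (\<Sum>p<n. A a p * quat_cnj (A b p))" for a b
  have blocks: "moore_det (\<lambda>a b. \<delta> a b - (s * s) *\<^sub>R M a b) {..<n} =
      moore_det (\<lambda>a b. \<delta> a b - (s * s) *\<^sub>R N a b) {..<n}" for s :: real
  proof -
    \<comment> \<open>The second block of indices is shifted by \<open>n\<close>. Both diagonal
      blocks are units, so either may serve as pivot: eliminating \<open>P\<close> leaves the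
      complement with \<open>M\<close>, eliminating \<open>Q\<close> the one with
      \<open>N\<close>.\<close>
    define K where "K a b = (if a < n then (if b < n then \<delta> a b else s *\<^sub>R A a (b - n))
      else (if b < n then s *\<^sub>R quat_cnj (A b (a - n)) else \<delta> a b))" for a b
    define P where "P = {..<n}"
    define Q where "Q = (\<lambda>i. n + i) ` {..<n}"
    have inj: "inj_on (\<lambda>i. n + i) {..<n}" by (simp add: inj_on_def)
    have fin: "finite P" "finite Q" "P \<inter> Q = {}" "Q \<inter> P = {}"
      by (auto simp: P_def Q_def)
    have herm: "hermitian_on K (P \<union> Q)"
      unfolding hermitian_on_def by (intro ballI) (simp add: K_def \<delta>_def)
    have "moore_det K (P \<union> Q) = moore_det (\<lambda>a b. K a b - (\<Sum>p\<in>P. K a p * K p b)) Q"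
      using fin herm by (intro moore_det_schur) (auto simp: K_def P_def \<delta>_def)
    also have "\<dots> = moore_det (\<lambda>a b. \<delta> a b - (s * s) *\<^sub>R M a b) {..<n}"
      unfolding Q_def by (subst moore_det_image[OF _ inj])
        (auto intro!: moore_det_cong simp: K_def P_def M_def \<delta>_def scaleR_sum_right)
    finally have 1: "moore_det K (P \<union> Q) = moore_det (\<lambda>a b. \<delta> a b - (s * s) *\<^sub>R M a b) {..<n}" .
    have "moore_det K (Q \<union> P) = moore_det (\<lambda>a b. K a b - (\<Sum>p\<in>Q. K a p * K p b)) P"
      using fin herm by (intro moore_det_schur) (auto simp: K_def Q_def \<delta>_def Un_commute)
    also have "\<dots> = moore_det (\<lambda>a b. \<delta> a b - (s * s) *\<^sub>R N a b) {..<n}"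
      unfolding P_def
    proof (rule moore_det_cong)
      fix a b assume ab: "a \<in> {..<n}" "b \<in> {..<n}"
      have "(\<Sum>p\<in>Q. K a p * K p b) = (s * s) *\<^sub>R N a b"
        unfolding Q_def using ab
        by (subst sum.reindex[OF inj]) (simp add: K_def N_def scaleR_sum_right)
      then show "K a b - (\<Sum>p\<in>Q. K a p * K p b) = \<delta> a b - (s * s) *\<^sub>R N a b"
        using ab by (simp add: K_def)
    qed
    finally show ?thesis using 1 by (simp add: Un_commute)
  qed
  \<comment> \<open>For \<open>t > 0\<close> this is a multiple of the determinant above with
    \<open>s = 1 / sqrt t\<close>. It remains meaningful at \<open>t = 0\<close>, where it is the
    determinant of \<open>H\<close> up to sign.\<close>
  define G where "G H t = moore_det (\<lambda>a b. of_real t * \<delta> a b - H a b) {..<n}"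
    for H :: "nat \<Rightarrow> nat \<Rightarrow> quat" and t
  have G_pos: "G H t = t ^ n * moore_det (\<lambda>a b. \<delta> a b - (1 / sqrt t * (1 / sqrt t)) *\<^sub>R H a b) {..<n}"
    if "t > 0" for H t
  proof -
    have "of_real t * \<delta> a b - H a b =
        t *\<^sub>R (\<delta> a b - (1 / sqrt t * (1 / sqrt t)) *\<^sub>R H a b)" for a b
      using that by (simp add: scaleR_right_diff_distrib scaleR_conv_of_real[symmetric])
    then show ?thesis
      using moore_det_scaleR[of "{..<n}" t] by (simp add: G_def)
  qed
  have G_cont: "(G H \<longlongrightarrow> G H 0) (at_right 0)" for H
  proof -
    have "continuous_on UNIV (G H)"
      unfolding G_def
      by (intro continuous_on_moore_det quat_continuous_diff quat_continuous_mult
          quat_continuous_of_real quat_continuous_const)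
    then have "isCont (G H) 0"
      by (simp add: continuous_on_eq_continuous_at)
    then show ?thesis
      by (metis isCont_def at_le subset_UNIV tendsto_mono)
  qed
  have "G M t = G N t" if "t > 0" for t
    by (simp only: G_pos[OF that] blocks)
  \<comment> \<open>Agreement for positive \<open>t\<close> is enough for the limits from the right,
    and these are unique.\<close>
  then have "eventually (\<lambda>t. G M t = G N t) (at_right 0)"
    unfolding eventually_at_filter by (intro always_eventually) auto
  with G_cont[of M] have "(G N \<longlongrightarrow> G M 0) (at_right 0)"
    by (rule Lim_transform_eventually)
  from tendsto_unique[OF _ this G_cont[of N]] have "G M 0 = G N 0"
    by simp
  moreover have "G H 0 = (-1) ^ n * moore_det H {..<n}" for H
    using moore_det_scaleR[of "{..<n}" "-1" H] by (simp add: G_def)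
  ultimately have "moore_det M {..<n} = moore_det N {..<n}"
    by simp
  then show ?thesis
    by (simp only: M_def[abs_def] N_def[abs_def])
qed

section \<open>Splitting a cycle off a permutation\<close>

lemma funpow_cong_on:
  assumes "\<And>a. a \<in> T \<Longrightarrow> p a = q a" "\<And>a. a \<in> T \<Longrightarrow> q a \<in> T" "k \<in> T"
  shows "(p ^^ m) k = (q ^^ m) k \<and> (q ^^ m) k \<in> T"
proof (induction m)
  case (Suc m)
  then show ?case
    using assms(1)[of "(q ^^ m) k"] assms(2)[of "(q ^^ m) k"] by simp
qed (use assms(3) in simp)

text \<open>All iterates starting at \<open>k\<close> stay in the invariant set \<open>T\<close>,
  where the two maps agree.\<close>

lemma support_cong_on:
  assumes "\<And>a. a \<in> T \<Longrightarrow> p a = q a" "\<And>a. a \<in> T \<Longrightarrow> q a \<in> T" "k \<in> T"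
  shows "support p k = support q k" and "set (support q k) \<subseteq> T"
proof -
  have eq: "(p ^^ m) k = (q ^^ m) k" "(q ^^ m) k \<in> T" for m
    using funpow_cong_on[of T p q k m] assms by auto
  then show "support p k = support q k" "set (support q k) \<subseteq> T"
    by (auto simp: least_power_def)
qed

text \<open>Applying the cycle rotates its list. The iterates of \<open>i\<close> thus run through
  the list and return to \<open>i\<close> for the first time after its full length.\<close>

lemma support_cycle_of_list:
  assumes "distinct (i # x)"
  shows "support (cycle_of_list (i # x)) i = i # x"
proof -
  let ?c = "i # x" and ?p = "cycle_of_list (i # x)"
  have pow: "(?p ^^ m) i = ?c ! (m mod length ?c)" for m
  proof -
    have "(?p ^^ m) i = map (?p ^^ m) ?c ! 0" by simp
    also have "\<dots> = rotate m ?c ! 0"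
      using cyclic_rotation[OF assms, of m] by simp
    also have "\<dots> = ?c ! (m mod length ?c)"
      by (subst nth_rotate) auto
    finally show ?thesis .
  qed
  have "least_power ?p i = length ?c"
    unfolding least_power_def
  proof (rule Least_equality)
    show "(?p ^^ length ?c) i = i \<and> 0 < length ?c"
      by (simp only: pow) simp
    fix m assume "(?p ^^ m) i = i \<and> 0 < m"
    then have m: "?c ! (m mod length ?c) = ?c ! 0" "0 < m"
      by (simp_all only: pow) simp
    have "m mod length ?c = 0"
      using assms m(1) by (subst (asm) nth_eq_iff_index_eq) auto
    with m(2) show "length ?c \<le> m"
      by (intro dvd_imp_le) auto
  qed
  then have "support ?p i = map (\<lambda>m. ?c ! m) [0..<length ?c]"
    by (simp only: pow) (auto intro!: map_cong simp del: upt_Suc)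
  also have "\<dots> = ?c" by (rule map_nth)
  finally show ?thesis .
qed

text \<open>\<open>\<tau>\<close> fixes the elements of \<open>i # x\<close>, and the cycle fixes
  all others. Each factor therefore determines the composite on its own invariant set.\<close>

lemma cycle_comp_permutes:
  assumes "x \<in> dlists (S - {i})" "i \<in> S" "\<tau> permutes (S - {i} - set x)"
  shows "(cycle_of_list (i # x) \<circ> \<tau>) permutes S"
    and "support (cycle_of_list (i # x) \<circ> \<tau>) i = i # x"
    and "map (cycle_of_list (i # x) \<circ> \<tau>) (i # x) = x @ [i]"
    and "\<And>k. k \<in> S - {i} - set x \<Longrightarrow> (cycle_of_list (i # x) \<circ> \<tau>) k = \<tau> k"
    and "\<And>k. k \<in> S - {i} - set x \<Longrightarrow> support (cycle_of_list (i # x) \<circ> \<tau>) k = support \<tau> k"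
    and "\<And>k. k \<in> S - {i} - set x \<Longrightarrow> set (support \<tau> k) \<subseteq> S - {i} - set x"
proof -
  let ?p = "cycle_of_list (i # x)" and ?T = "S - {i} - set x"
  have dist: "distinct (i # x)" and sub: "set (i # x) \<subseteq> S"
    using assms(1,2) by (auto simp: dlists_def)
  have "?p permutes S" "\<tau> permutes S"
    using permutes_subset[OF cycle_permutes sub] permutes_subset[OF assms(3), of S] by auto
  then show "(?p \<circ> \<tau>) permutes S"
    by (rule permutes_compose[rotated])
  have \<tau>: "\<tau> a = a" if "a \<in> set (i # x)" for a
    using that by (intro permutes_not_in[OF assms(3)]) auto
  have p: "?p a \<in> set (i # x)" if "a \<in> set (i # x)" for a
    by (rule iffD2[OF permutes_in_image[OF cycle_permutes] that])
  have "support (?p \<circ> \<tau>) i = support ?p i"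
  proof (rule support_cong_on(1)[where T = "set (i # x)"])
    show "(?p \<circ> \<tau>) a = ?p a" if "a \<in> set (i # x)" for a
      using \<tau>[OF that] by simp
    show "?p a \<in> set (i # x)" if "a \<in> set (i # x)" for a
      by (rule p[OF that])
  qed simp
  then show "support (?p \<circ> \<tau>) i = i # x"
    using support_cycle_of_list[OF dist] by simp
  have "map (?p \<circ> \<tau>) (i # x) = map ?p (i # x)"
    by (rule map_cong[OF refl]) (use \<tau> in simp)
  also have "\<dots> = x @ [i]"
    using cyclic_rotation[OF dist, of 1] by simp
  finally show "map (?p \<circ> \<tau>) (i # x) = x @ [i]" .
  have T: "\<tau> k \<in> ?T" if "k \<in> ?T" for k
    by (rule iffD2[OF permutes_in_image[OF assms(3)] that])
  show eq: "(?p \<circ> \<tau>) k = \<tau> k" if "k \<in> ?T" for k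
    using T[OF that] by (simp add: id_outside_supp)
  show "support (?p \<circ> \<tau>) k = support \<tau> k" if "k \<in> ?T" for k
    by (rule support_cong_on(1)[where p = "?p \<circ> \<tau>" and q = \<tau> and T = ?T, OF eq T that])
  show "set (support \<tau> k) \<subseteq> ?T" if "k \<in> ?T" for k
    by (rule support_cong_on(2)[where p = "?p \<circ> \<tau>" and q = \<tau> and T = ?T, OF eq T that])
qed

text \<open>Undoing the cycle through \<open>i\<close> after \<open>\<sigma>\<close> fixes every
  element of that cycle, so what is left permutes the remaining elements.\<close>

lemma permutes_split_cycle:
  assumes "finite S" "i \<in> S" "\<sigma> permutes S"
  obtains x where "support \<sigma> i = i # x" "x \<in> dlists (S - {i})"
    "(inv_into UNIV (cycle_of_list (i # x)) \<circ> \<sigma>) permutes (S - {i} - set x)"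
proof -
  have perm: "permutation \<sigma>"
    using assms by (auto simp: permutation_permutes)
  define x where "x = map (\<lambda>m. (\<sigma> ^^ m) i) [1..<least_power \<sigma> i]"
  have supp: "support \<sigma> i = i # x"
    using least_power_of_permutation(2)[OF perm, of i] by (simp add: upt_conv_Cons x_def)
  have dist: "distinct (i # x)"
    using cycle_of_permutation[OF perm, of i] supp by simp
  have "(\<sigma> ^^ m) i \<in> S" for m
    by (rule iffD2[OF permutes_in_image[OF permutes_funpow[OF assms(3)]] assms(2)])
  then have "set x \<subseteq> S"
    by (auto simp: x_def)
  then have x: "x \<in> dlists (S - {i})"
    using dist by (auto simp: dlists_def)
  let ?p = "cycle_of_list (i # x)"
  have p: "?p permutes S"
    using permutes_subset[OF cycle_permutes, of "i # x" S] x assms(2) by (auto simp: dlists_def)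
  have "(inv_into UNIV ?p \<circ> \<sigma>) permutes S"
    by (rule permutes_compose[OF assms(3) permutes_inv[OF p]])
  then have "(inv_into UNIV ?p \<circ> \<sigma>) permutes (S - {i} - set x)"
  proof (rule permutes_superset)
    fix a assume "a \<in> S - (S - {i} - set x)"
    then have "a \<in> set (support \<sigma> i)" unfolding supp by auto
    from cycle_restrict[OF perm this] have "\<sigma> a = ?p a"
      unfolding supp .
    then show "(inv_into UNIV ?p \<circ> \<sigma>) a = a"
      using permutes_inverses(2)[OF p] by simp
  qed
  with supp x show ?thesis by (rule that)
qed

text \<open>A permutation amounts to its cycle through \<open>i\<close> together with a permutation
  of the elements off that cycle. This matches the expansion of \<open>moore_det\<close> along
  \<open>i\<close>.\<close>

lemma sum_permutes_split:
  assumes "finite S" "i \<in> S"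
  shows "(\<Sum>\<sigma> | \<sigma> permutes S. g \<sigma>) =
    (\<Sum>x\<in>dlists (S - {i}). \<Sum>\<tau> | \<tau> permutes (S - {i} - set x). g (cycle_of_list (i # x) \<circ> \<tau>))"
proof -
  let ?D = "Sigma (dlists (S - {i})) (\<lambda>x. {\<tau>. \<tau> permutes (S - {i} - set x)})"
  let ?u = "\<lambda>(x, \<tau>). cycle_of_list (i # x) \<circ> \<tau>"
  let ?v = "\<lambda>\<sigma>. (tl (support \<sigma> i), inv_into UNIV (cycle_of_list (support \<sigma> i)) \<circ> \<sigma>)"
  have bij: "bij (cycle_of_list (i # x))" for x
    using permutation_bijective[OF permutation_of_cycle] .
  have "(\<Sum>\<sigma> | \<sigma> permutes S. g \<sigma>) = (\<Sum>p\<in>?D. g (?u p))"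
  proof (rule sum.reindex_bij_witness[of _ ?u ?v])
    fix \<sigma> assume "\<sigma> \<in> {\<sigma>. \<sigma> permutes S}"
    then have "\<sigma> permutes S" by simp
    then obtain x where x: "support \<sigma> i = i # x" "x \<in> dlists (S - {i})"
      "(inv_into UNIV (cycle_of_list (i # x)) \<circ> \<sigma>) permutes (S - {i} - set x)"
      by (rule permutes_split_cycle[OF assms])
    show "?v \<sigma> \<in> ?D" using x unfolding x(1) by simp
    have "cycle_of_list (i # x) \<circ> (inv_into UNIV (cycle_of_list (i # x)) \<circ> \<sigma>) = \<sigma>"
      unfolding comp_assoc[symmetric] surj_iff[THEN iffD1, OF bij_is_surj[OF bij]] by simp
    then show "?u (?v \<sigma>) = \<sigma>" "g (?u (?v \<sigma>)) = g \<sigma>"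
      unfolding x(1) by simp_all
  next
    fix p assume p: "p \<in> ?D"
    obtain x \<tau> where xt: "p = (x, \<tau>)" by (cases p)
    with p have x: "x \<in> dlists (S - {i})" and \<tau>: "\<tau> permutes (S - {i} - set x)" by auto
    note cp = cycle_comp_permutes[OF x assms(2) \<tau>]
    show "?u p \<in> {\<sigma>. \<sigma> permutes S}" using cp(1) by (simp add: xt)
    have "inv_into UNIV (cycle_of_list (i # x)) \<circ> (cycle_of_list (i # x) \<circ> \<tau>) = \<tau>"
      unfolding comp_assoc[symmetric] inv_o_cancel[OF bij_is_inj[OF bij]] by simp
    then show "?v (?u p) = p"
      unfolding xt prod.case cp(2) by simp
  qed
  also have "\<dots> = (\<Sum>(x, \<tau>)\<in>?D. g (cycle_of_list (i # x) \<circ> \<tau>))"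
    by (rule sum.cong[OF refl]) (simp only: case_prod_unfold)
  also have "\<dots> = (\<Sum>x\<in>dlists (S - {i}). \<Sum>\<tau> | \<tau> permutes (S - {i} - set x).
      g (cycle_of_list (i # x) \<circ> \<tau>))"
    by (rule sum.Sigma[symmetric]) (use assms(1) in \<open>simp_all add: finite_permutations\<close>)
  finally show ?thesis .
qed

section \<open>Row and column determinants\<close>

text \<open>The flag is set for column determinants, which list the cycles in the reverse order.\<close>

definition oriented_prod :: "bool \<Rightarrow> quat list \<Rightarrow> quat" where
  "oriented_prod r l = prod_list (if r then rev l else l)"

lemma oriented_prod_Cons:
  "oriented_prod r (a # l) = (if r then oriented_prod r l * a else a * oriented_prod r l)"
  by (simp add: oriented_prod_def)

text \<open>For a permutation of \<open>T\<close> these elements represent its cycles, one each;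
  they open the cycles in the ordered form, and their number is the number of cycles.\<close>

definition cycle_minima :: "nat set \<Rightarrow> (nat \<Rightarrow> nat) \<Rightarrow> nat set" where
  "cycle_minima T \<sigma> = {k \<in> T. \<forall>m\<in>set (support \<sigma> k). k \<le> m}"

definition cycle_walk :: "(nat \<Rightarrow> nat \<Rightarrow> quat) \<Rightarrow> (nat \<Rightarrow> nat) \<Rightarrow> nat \<Rightarrow> quat" where
  "cycle_walk f \<sigma> k = prod_list (map (\<lambda>a. f a (\<sigma> a)) (support \<sigma> k))"

text \<open>Every cycle is opened by its least element here, with no distinguished first index.
  Adding the number of cycles instead of subtracting it leaves the parity unchanged and avoids
  truncated subtraction.\<close>

definition cycles_term :: "bool \<Rightarrow> (nat \<Rightarrow> nat \<Rightarrow> quat) \<Rightarrow> nat set \<Rightarrow> (nat \<Rightarrow> nat) \<Rightarrow> quat" where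
  "cycles_term r f T \<sigma> = (-1) ^ (card T + card (cycle_minima T \<sigma>)) *\<^sub>R
     oriented_prod r (map (cycle_walk f \<sigma>) (sorted_list_of_set (cycle_minima T \<sigma>)))"

lemma prod_list_eq_walk:
  "map \<sigma> (i # x) = x @ [z] \<Longrightarrow> prod_list (map (\<lambda>a. f a (\<sigma> a)) (i # x)) = walk f (i # x @ [z])"
  by (induction x arbitrary: i) auto

section \<open>Cycle products and signs after a cycle is split off\<close>

context
  fixes S :: "nat set" and i :: nat and x :: "nat list" and \<tau> :: "nat \<Rightarrow> nat"
  assumes fin: "finite S" and i: "i \<in> S" and x: "x \<in> dlists (S - {i})"
    and \<tau>: "\<tau> permutes (S - {i} - set x)"
begin

lemma cycle_walk_split:
  "cycle_walk f (cycle_of_list (i # x) \<circ> \<tau>) i = walk f (i # x @ [i])"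
  "k \<in> S - {i} - set x \<Longrightarrow> cycle_walk f (cycle_of_list (i # x) \<circ> \<tau>) k = cycle_walk f \<tau> k"
proof -
  note cp = cycle_comp_permutes[OF x i \<tau>]
  show "cycle_walk f (cycle_of_list (i # x) \<circ> \<tau>) i = walk f (i # x @ [i])"
    unfolding cycle_walk_def cp(2) by (rule prod_list_eq_walk[OF cp(3)])
  assume k: "k \<in> S - {i} - set x"
  show "cycle_walk f (cycle_of_list (i # x) \<circ> \<tau>) k = cycle_walk f \<tau> k"
    unfolding cycle_walk_def cp(5)[OF k]
  proof (intro arg_cong[of _ _ prod_list] map_cong refl)
    fix a assume "a \<in> set (support \<tau> k)"
    then have "a \<in> S - {i} - set x" using cp(6)[OF k] by blast
    then show "f a ((cycle_of_list (i # x) \<circ> \<tau>) a) = f a (\<tau> a)"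
      using cp(4) by simp
  qed
qed

lemma oriented_prod_split:
  "oriented_prod r (map (cycle_walk f (cycle_of_list (i # x) \<circ> \<tau>))
      (i # sorted_list_of_set (cycle_minima (S - {i} - set x) \<tau>))) =
    (if r then oriented_prod r (map (cycle_walk f \<tau>)
        (sorted_list_of_set (cycle_minima (S - {i} - set x) \<tau>))) * walk f (i # x @ [i])
     else walk f (i # x @ [i]) * oriented_prod r (map (cycle_walk f \<tau>)
        (sorted_list_of_set (cycle_minima (S - {i} - set x) \<tau>))))"
proof -
  let ?M = "sorted_list_of_set (cycle_minima (S - {i} - set x) \<tau>)"
  have "set ?M \<subseteq> S - {i} - set x"
    using fin by (subst set_sorted_list_of_set) (auto simp: cycle_minima_def)
  then have "map (cycle_walk f (cycle_of_list (i # x) \<circ> \<tau>)) ?M = map (cycle_walk f \<tau>) ?M"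
    by (intro map_cong refl cycle_walk_split(2)) auto
  then show ?thesis
    by (simp only: list.map(2) oriented_prod_Cons cycle_walk_split(1))
qed

text \<open>The left-hand side is the set that \<open>ordered_cycles\<close> sorts to open the
  cycles other than the one through \<open>i\<close>.\<close>

lemma cycle_minima_split:
  "{k \<in> S. k \<notin> set (support (cycle_of_list (i # x) \<circ> \<tau>) i) \<and>
      (\<forall>m\<in>set (support (cycle_of_list (i # x) \<circ> \<tau>) k). k \<le> m)} =
    cycle_minima (S - {i} - set x) \<tau>"
proof -
  note cp = cycle_comp_permutes[OF x i \<tau>]
  have "(\<forall>m\<in>set (support (cycle_of_list (i # x) \<circ> \<tau>) k). k \<le> m) \<longleftrightarrow>
      (\<forall>m\<in>set (support \<tau> k). k \<le> m)" if "k \<in> S - {i} - set x" for k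
    unfolding cp(5)[OF that] ..
  then show ?thesis
    unfolding cp(2) cycle_minima_def by (auto simp del: set_map)
qed

text \<open>The least element \<open>i\<close> of \<open>S\<close> is the minimum of its own cycle,
  so the elements of \<open>x\<close>, which share that cycle, are not minima.\<close>

lemma cycle_minima_split_Min:
  assumes Min: "i = Min S"
  shows "cycle_minima S (cycle_of_list (i # x) \<circ> \<tau>) =
    insert i (cycle_minima (S - {i} - set x) \<tau>)"
proof -
  let ?p = "cycle_of_list (i # x) \<circ> \<tau>"
  note cp = cycle_comp_permutes[OF x i \<tau>]
  have perm: "permutation ?p"
    using cp(1) fin by (auto simp: permutation_permutes)
  have x': "set x \<subseteq> S" "i \<notin> set x"
    using x by (auto simp: dlists_def)
  have "i \<le> k" if "k \<in> S" for k
    using that fin by (simp add: Min)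
  then have 1: "i \<in> cycle_minima S ?p"
    unfolding cycle_minima_def mem_Collect_eq cp(2) using i x' by auto
  have 2: "k \<notin> cycle_minima S ?p" if "k \<in> set x" for k
  proof
    assume "k \<in> cycle_minima S ?p"
    then have le: "\<forall>m\<in>set (support ?p k). k \<le> m" by (simp add: cycle_minima_def)
    have "k \<in> set (support ?p i)" using that unfolding cp(2) by simp
    then have "set (support ?p k) \<inter> set (support ?p i) \<noteq> {}"
      using disjoint_support'[OF perm, of k i] by blast
    then have "i \<in> set (support ?p k)"
      using disjoint_support'[OF perm, of i k] by blast
    with le have "k \<le> i" by blast
    moreover have "i \<le> k" "k \<noteq> i"
      using that x' fin by (auto simp: Min)
    ultimately show False by simp
  qed
  have 3: "k \<in> cycle_minima S ?p \<longleftrightarrow> k \<in> cycle_minima (S - {i} - set x) \<tau>"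
    if "k \<in> S - {i} - set x" for k
    using that unfolding cycle_minima_def mem_Collect_eq cp(5)[OF that] by blast
  show ?thesis
  proof (intro equalityI subsetI)
    fix k assume k: "k \<in> cycle_minima S ?p"
    then have "k \<in> S" by (simp add: cycle_minima_def)
    then show "k \<in> insert i (cycle_minima (S - {i} - set x) \<tau>)"
      using k 2[of k] 3[of k] by blast
  next
    fix k assume k: "k \<in> insert i (cycle_minima (S - {i} - set x) \<tau>)"
    then have "k = i \<or> k \<in> S - {i} - set x"
      by (auto simp: cycle_minima_def)
    then show "k \<in> cycle_minima S ?p"
      using k 1 3[of k] by blast
  qed
qed

lemma card_split: "card S = Suc (length x + card (S - {i} - set x))"
proof -
  have "length x = card (set x)" "set x \<subseteq> S - {i}"
    using x by (auto simp: dlists_def distinct_card)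
  then show ?thesis
    using fin i card_Suc_Diff1[OF fin i] card_mono[of "S - {i}" "set x"]
    by (simp add: card_Diff_subset)
qed

text \<open>As \<open>i\<close> is least, its cycle comes first in the sorted order and its factor
  is outermost. Compared with the remaining set, the size grows by \<open>length x + 1\<close> and
  the number of cycles by one, which leaves the sign \<open>(-1) ^ length x\<close>.\<close>

lemma cycles_term_split:
  assumes "i = Min S"
  shows "cycles_term r f S (cycle_of_list (i # x) \<circ> \<tau>) = (-1) ^ length x *\<^sub>R
    (if r then cycles_term r f (S - {i} - set x) \<tau> * walk f (i # x @ [i])
     else walk f (i # x @ [i]) * cycles_term r f (S - {i} - set x) \<tau>)"
proof -
  let ?B = "cycle_minima (S - {i} - set x) \<tau>"
  have B: "finite ?B" "i \<notin> ?B" "?B \<subseteq> S"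
    using fin by (auto simp: cycle_minima_def)
  have Min: "Min (insert i ?B) = i"
    using B fin by (intro Min_eqI) (auto simp: assms)
  have sorted: "sorted_list_of_set (insert i ?B) = i # sorted_list_of_set ?B"
    using B Min by (subst sorted_list_of_set_nonempty) auto
  have "card S + card (insert i ?B) = length x + (card (S - {i} - set x) + card ?B) + 2"
    using card_split B by simp
  then have sign: "(-1::real) ^ (card S + card (insert i ?B)) =
      (-1) ^ length x * (-1) ^ (card (S - {i} - set x) + card ?B)"
    by (simp add: power_add)
  show ?thesis
    unfolding cycles_term_def cycle_minima_split_Min[OF assms] sorted oriented_prod_split sign
    by simp
qed

end

text \<open>By induction the sum over the permutations off the cycle of \<open>Min T\<close> is
  real. It commutes with the product of that cycle, so both orientations satisfy the recursion of
  \<open>moore_det\<close>.\<close>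

lemma sum_cycles_term:
  assumes "finite T" "hermitian_on f T"
  shows "(\<Sum>\<sigma> | \<sigma> permutes T. cycles_term r f T \<sigma>) = of_real (moore_det f T)"
  using assms
proof (induction T rule: finite_psubset_induct)
  case (psubset T)
  show ?case
  proof (cases "T = {}")
    case True
    then show ?thesis
      by (simp add: cycles_term_def cycle_minima_def oriented_prod_def)
  next
    case False
    define i where "i = Min T"
    have i: "i \<in> T" using psubset.hyps False by (simp add: i_def)
    have "(\<Sum>\<sigma> | \<sigma> permutes T. cycles_term r f T \<sigma>) =
        (\<Sum>x\<in>dlists (T - {i}). \<Sum>\<tau> | \<tau> permutes (T - {i} - set x).
          cycles_term r f T (cycle_of_list (i # x) \<circ> \<tau>))"
      by (rule sum_permutes_split[OF psubset.hyps i])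
    also have "\<dots> = (\<Sum>x\<in>dlists (T - {i}).
        ((-1) ^ length x * moore_det f (T - {i} - set x)) *\<^sub>R walk f (i # x @ [i]))"
    proof (rule sum.cong[OF refl])
      fix x assume x: "x \<in> dlists (T - {i})"
      let ?T = "T - {i} - set x" and ?w = "walk f (i # x @ [i])"
      have IH: "(\<Sum>\<tau> | \<tau> permutes ?T. cycles_term r f ?T \<tau>) = of_real (moore_det f ?T)"
        using i by (intro psubset.IH hermitian_on_subset[OF psubset.prems]) auto
      have "(\<Sum>\<tau> | \<tau> permutes ?T. cycles_term r f T (cycle_of_list (i # x) \<circ> \<tau>)) =
          (\<Sum>\<tau> | \<tau> permutes ?T. (-1) ^ length x *\<^sub>R
            (if r then cycles_term r f ?T \<tau> * ?w else ?w * cycles_term r f ?T \<tau>))"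
        by (rule sum.cong[OF refl], rule cycles_term_split[OF psubset.hyps i x _ i_def]) simp
      also have "\<dots> = (-1) ^ length x *\<^sub>R (if r
          then (\<Sum>\<tau> | \<tau> permutes ?T. cycles_term r f ?T \<tau>) * ?w
          else ?w * (\<Sum>\<tau> | \<tau> permutes ?T. cycles_term r f ?T \<tau>))"
        by (simp add: scaleR_sum_right sum_distrib_left sum_distrib_right)
      also have "\<dots> = ((-1) ^ length x * moore_det f ?T) *\<^sub>R ?w"
        unfolding IH by (simp add: of_real_def)
      finally show "(\<Sum>\<tau> | \<tau> permutes ?T. cycles_term r f T (cycle_of_list (i # x) \<circ> \<tau>)) =
          ((-1) ^ length x * moore_det f ?T) *\<^sub>R ?w" .
    qed
    also have "\<dots> = of_real (moore_det f T)"
      by (rule moore_det_expand_quat[OF psubset.hyps i psubset.prems])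
    finally show ?thesis .
  qed
qed

section \<open>Determinants of matrices as sums over closed walks\<close>

definition entries :: "quat mat \<Rightarrow> nat \<Rightarrow> nat \<Rightarrow> quat" where
  "entries A a b = A $$ (a, b)"

text \<open>Only the minors avoiding \<open>i\<close> have to be real, so the matrix has to be
  Hermitian only off row and column \<open>i\<close>. This covers a Hermitian matrix whose
  \<open>i\<close>th row has been replaced.\<close>

lemma sum_ordered_cycles:
  assumes "i < n" "hermitian_on (entries A) ({..<n} - {i})"
  shows "(\<Sum>\<sigma> | \<sigma> permutes {..<n}. (-1) ^ (n - length (ordered_cycles n \<sigma> i)) *
      oriented_prod r (map (cycle_prod A \<sigma>) (ordered_cycles n \<sigma> i))) =
    (\<Sum>x\<in>dlists ({..<n} - {i}). ((-1) ^ length x * moore_det (entries A) ({..<n} - {i} - set x)) *\<^sub>R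
      walk (entries A) (i # x @ [i]))"
proof -
  define f where "f = entries A"
  define S where "S = {..<n}"
  define g where "g \<sigma> = (-1) ^ (n - length (ordered_cycles n \<sigma> i)) *
      oriented_prod r (map (cycle_prod A \<sigma>) (ordered_cycles n \<sigma> i))" for \<sigma>
  have fin: "finite S" and i: "i \<in> S" using assms(1) by (auto simp: S_def)
  have split: "g (cycle_of_list (i # x) \<circ> \<tau>) = (-1) ^ length x *\<^sub>R
      (if r then cycles_term r f (S - {i} - set x) \<tau> * walk f (i # x @ [i])
       else walk f (i # x @ [i]) * cycles_term r f (S - {i} - set x) \<tau>)"
    if x: "x \<in> dlists (S - {i})" and \<tau>: "\<tau> permutes (S - {i} - set x)" for x \<tau>
  proof -
    let ?p = "cycle_of_list (i # x) \<circ> \<tau>" and ?T = "S - {i} - set x"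
    let ?B = "cycle_minima ?T \<tau>"
    have cycles: "ordered_cycles n ?p i = map (support ?p) (i # sorted_list_of_set ?B)"
      using cycle_minima_split[OF fin i x \<tau>] by (simp add: ordered_cycles_def S_def)
    have "card ?B \<le> card ?T"
      using fin by (intro card_mono) (auto simp: cycle_minima_def)
    then obtain d where d: "card ?T = card ?B + d"
      using le_Suc_ex by blast
    \<comment> \<open>There are \<open>card ?B + 1\<close> cycles and
      \<open>length x + 1 + card ?T\<close> elements, so the natural subtraction does not
      truncate.\<close>
    then have "n - length (ordered_cycles n ?p i) = length x + d"
      using card_split[OF fin i x \<tau>] by (simp add: cycles S_def)
    moreover have "(-1::real) ^ (card ?T + card ?B) = (-1) ^ d"
      unfolding d by (simp add: power_add mult.assoc[symmetric] power_mult_distrib[symmetric])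
    ultimately have "(-1::real) ^ (n - length (ordered_cycles n ?p i)) =
        (-1) ^ length x * (-1) ^ (card ?T + card ?B)"
      by (simp add: power_add)
    moreover have "map (cycle_prod A ?p) (ordered_cycles n ?p i) =
        map (cycle_walk f ?p) (i # sorted_list_of_set ?B)"
      unfolding cycles map_map
      by (intro map_cong refl) (simp add: cycle_prod_def cycle_walk_def f_def entries_def comp_def)
    moreover have "(-1) ^ m * q = (-1::real) ^ m *\<^sub>R q" for m and q :: quat
      by (simp add: scaleR_conv_of_real)
    ultimately show ?thesis
      unfolding g_def by (simp only: oriented_prod_split[OF fin i x \<tau>] cycles_term_def) simp
  qed
  have "(\<Sum>\<sigma> | \<sigma> permutes S. g \<sigma>) =
      (\<Sum>x\<in>dlists (S - {i}). \<Sum>\<tau> | \<tau> permutes (S - {i} - set x). g (cycle_of_list (i # x) \<circ> \<tau>))"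
    by (rule sum_permutes_split[OF fin i])
  also have "\<dots> = (\<Sum>x\<in>dlists (S - {i}).
      ((-1) ^ length x * moore_det f (S - {i} - set x)) *\<^sub>R walk f (i # x @ [i]))"
  proof (rule sum.cong[OF refl])
    fix x assume x: "x \<in> dlists (S - {i})"
    let ?T = "S - {i} - set x" and ?w = "walk f (i # x @ [i])"
    have minor: "(\<Sum>\<tau> | \<tau> permutes ?T. cycles_term r f ?T \<tau>) = of_real (moore_det f ?T)"
      using fin hermitian_on_subset[OF assms(2), of ?T]
      by (intro sum_cycles_term) (auto simp: f_def S_def)
    have "(\<Sum>\<tau> | \<tau> permutes ?T. g (cycle_of_list (i # x) \<circ> \<tau>)) =
        (\<Sum>\<tau> | \<tau> permutes ?T. (-1) ^ length x *\<^sub>R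
          (if r then cycles_term r f ?T \<tau> * ?w else ?w * cycles_term r f ?T \<tau>))"
      by (rule sum.cong[OF refl], rule split[OF x]) simp
    also have "\<dots> = (-1) ^ length x *\<^sub>R (if r
        then (\<Sum>\<tau> | \<tau> permutes ?T. cycles_term r f ?T \<tau>) * ?w
        else ?w * (\<Sum>\<tau> | \<tau> permutes ?T. cycles_term r f ?T \<tau>))"
      by (simp add: scaleR_sum_right sum_distrib_left sum_distrib_right)
    also have "\<dots> = ((-1) ^ length x * moore_det f ?T) *\<^sub>R ?w"
      unfolding minor by (simp add: of_real_def)
    finally show "(\<Sum>\<tau> | \<tau> permutes ?T. g (cycle_of_list (i # x) \<circ> \<tau>)) =
        ((-1) ^ length x * moore_det f ?T) *\<^sub>R ?w" .
  qed
  finally show ?thesis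
    by (simp only: g_def f_def S_def)
qed

lemma rdet_expand:
  assumes "i < n" "dim_row A = n" "hermitian_on (entries A) ({..<n} - {i})"
  shows "rdet i A = (\<Sum>x\<in>dlists ({..<n} - {i}).
    ((-1) ^ length x * moore_det (entries A) ({..<n} - {i} - set x)) *\<^sub>R
      walk (entries A) (i # x @ [i]))"
  using sum_ordered_cycles[OF assms(1,3), of False]
  by (simp add: rdet_def assms(2) oriented_prod_def Let_def)

lemma cdet_expand:
  assumes "i < n" "dim_row A = n" "hermitian_on (entries A) ({..<n} - {i})"
  shows "cdet i A = (\<Sum>x\<in>dlists ({..<n} - {i}).
    ((-1) ^ length x * moore_det (entries A) ({..<n} - {i} - set x)) *\<^sub>R
      walk (entries A) (i # x @ [i]))"
  using sum_ordered_cycles[OF assms(1,3), of True]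
  by (simp add: cdet_def assms(2) oriented_prod_def Let_def rev_map)

lemma rdet_cdet_hermitian:
  assumes "i < n" "dim_row A = n" "hermitian_on (entries A) {..<n}"
  shows "rdet i A = of_real (moore_det (entries A) {..<n})"
    and "cdet i A = of_real (moore_det (entries A) {..<n})"
  using assms hermitian_on_subset[OF assms(3), of "{..<n} - {i}"]
    moore_det_expand_quat[of "{..<n}" i "entries A"]
  by (simp_all add: rdet_expand cdet_expand)

lemma hdet_eq_moore_det:
  assumes "n \<ge> 1" "dim_row M = n" "hermitian_on (entries M) {..<n}"
  shows "hdet M = moore_det (entries M) {..<n}"
  unfolding hdet_def assms(2)
proof (rule the_equality)
  show "\<forall>i<n. rdet i M = of_real (moore_det (entries M) {..<n}) \<and>
      cdet i M = of_real (moore_det (entries M) {..<n})"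
    using rdet_cdet_hermitian[OF _ assms(2,3)] by blast
  \<comment> \<open>Because \<open>n\<close> is positive, index 0 is available and its row
    determinant pins down \<open>d\<close>.\<close>
  fix d assume "\<forall>i<n. rdet i M = of_real d \<and> cdet i M = of_real d"
  with assms(1) have "rdet 0 M = of_real d" by auto
  then show "d = moore_det (entries M) {..<n}"
    using rdet_cdet_hermitian(1)[OF _ assms(2,3), of 0] assms(1) by simp
qed

section \<open>Cramer's rule\<close>

lemma index_mult_entries:
  assumes "X \<in> carrier_mat n n" "M \<in> carrier_mat n n" "i < n" "l < n"
  shows "(X * M) $$ (i, l) = (\<Sum>k<n. X $$ (i, k) * entries M k l)"
  using assms by (auto simp: scalar_prod_def entries_def atLeast0LessThan)

text \<open>Row \<open>k\<close> is paired with the cofactors of row \<open>j\<close>. For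
  \<open>k\<close> different from \<open>j\<close> this is the expansion of a determinant with a
  repeated row, which vanishes as a sum of open walks.\<close>

lemma sum_walks_orthogonal:
  assumes "finite S" "k \<in> S" "j \<in> S" "hermitian_on f S"
  shows "(\<Sum>x\<in>dlists (S - {j}). ((-1) ^ length x * moore_det f (S - {j} - set x)) *\<^sub>R
    walk f (k # x @ [j])) = (if k = j then of_real (moore_det f S) else 0)"
proof (cases "k = j")
  case True
  then show ?thesis using moore_det_expand_quat[OF assms(1,3,4)] by simp
next
  case False
  then have "k \<in> S - {j}" using assms(2) by simp
  moreover have "hermitian_on f (S - {j})"
    using assms(4) by (rule hermitian_on_subset) auto
  ultimately show ?thesis
    using sum_open_walks_eq_0[of "S - {j}" k f "\<lambda>z. f z j"] assms(1) False
    unfolding walk_snoc by simp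
qed

lemma walk_Cons: "walk f (k # x @ [j]) = f k (hd (x @ [j])) * walk f (x @ [j])"
  by (cases x) auto

text \<open>In each term the entry of row \<open>j\<close> stands leftmost, so the coefficients
  \<open>c k\<close> can be pulled out on the left. Orthogonality to the cofactors then leaves only
  \<open>k = j\<close>.\<close>

lemma rdet_replace_row:
  assumes "M \<in> carrier_mat n n" "hermitian_on (entries M) {..<n}" "j < n"
    and b: "\<And>l. l < n \<Longrightarrow> b $ l = (\<Sum>k<n. c k * entries M k l)"
  shows "rdet j (replace_row M j b) = c j * of_real (moore_det (entries M) {..<n})"
proof -
  define f where "f = entries M"
  define S where "S = {..<n}"
  let ?h = "entries (replace_row M j b)"
  have dim: "dim_row M = n" "dim_col M = n" using assms(1) by auto
  have fin: "finite S" and j: "j \<in> S" using assms(3) by (auto simp: S_def)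
  have h: "?h a l = (if a = j then b $ l else f a l)" if "a < n" "l < n" for a l
    using that by (simp add: entries_def replace_row_def dim f_def)
  have herm: "hermitian_on f S" using assms(2) by (simp add: f_def S_def)
  have "hermitian_on ?h ({..<n} - {j})"
    unfolding hermitian_on_def
  proof (intro ballI)
    fix a l assume al: "a \<in> {..<n} - {j}" "l \<in> {..<n} - {j}"
    then have "?h l a = f l a" "?h a l = f a l" by (simp_all add: h)
    then show "?h l a = quat_cnj (?h a l)"
      using hermitian_onD[OF herm, of a l] al by (simp add: S_def)
  qed
  then have "rdet j (replace_row M j b) = (\<Sum>x\<in>dlists (S - {j}).
      ((-1) ^ length x * moore_det ?h (S - {j} - set x)) *\<^sub>R walk ?h (j # x @ [j]))"
    unfolding S_def using assms(3) dim by (intro rdet_expand) (auto simp: replace_row_def)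
  also have "\<dots> = (\<Sum>x\<in>dlists (S - {j}). \<Sum>k\<in>S.
      c k * (((-1) ^ length x * moore_det f (S - {j} - set x)) *\<^sub>R walk f (k # x @ [j])))"
  proof (rule sum.cong[OF refl])
    fix x assume "x \<in> dlists (S - {j})"
    then have x: "set x \<subseteq> S - {j}" by (auto simp: dlists_def)
    have minor: "moore_det ?h (S - {j} - set x) = moore_det f (S - {j} - set x)"
      by (rule moore_det_cong) (simp add: h S_def)
    \<comment> \<open>After its first step the walk meets \<open>j\<close> only at its end, so the
      replaced row is not read again.\<close>
    have tail: "walk ?h (x @ [j]) = walk f (x @ [j])"
    proof (rule walk_cong_butlast)
      fix a l assume "a \<in> set (butlast (x @ [j]))" "l \<in> set (x @ [j])"
      then have "a < n" "a \<noteq> j" "l < n"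
        using x assms(3) by (auto simp: S_def)
      then show "?h a l = f a l" by (simp add: h)
    qed
    have "hd (x @ [j]) < n" using x assms(3) by (cases x) (auto simp: S_def)
    then have "walk ?h (j # x @ [j]) = (\<Sum>k\<in>S. c k * walk f (k # x @ [j]))"
      unfolding walk_Cons tail using assms(3)
      by (simp add: h b f_def S_def sum_distrib_right mult.assoc)
    then show "((-1) ^ length x * moore_det ?h (S - {j} - set x)) *\<^sub>R walk ?h (j # x @ [j]) =
        (\<Sum>k\<in>S. c k * (((-1) ^ length x * moore_det f (S - {j} - set x)) *\<^sub>R walk f (k # x @ [j])))"
      by (simp add: minor scaleR_sum_right)
  qed
  also have "\<dots> = (\<Sum>k\<in>S. c k * (\<Sum>x\<in>dlists (S - {j}).
      ((-1) ^ length x * moore_det f (S - {j} - set x)) *\<^sub>R walk f (k # x @ [j])))"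
    unfolding sum_distrib_left by (rule sum.swap)
  also have "\<dots> = (\<Sum>k\<in>S. if k = j then c k * of_real (moore_det f S) else 0)"
    by (intro sum.cong refl) (simp add: sum_walks_orthogonal[OF fin _ j herm])
  also have "\<dots> = c j * of_real (moore_det f S)"
    using fin j by simp
  finally show ?thesis by (simp add: f_def S_def)
qed

text \<open>The cofactors form a right inverse up to the real factor \<open>D\<close>. As
  \<open>M\<close> is Hermitian, taking adjoints turns it into a left inverse.\<close>

lemma hermitian_left_inverse:
  assumes M: "M \<in> carrier_mat n n" and herm: "hermitian_on (entries M) {..<n}"
    and nz: "moore_det (entries M) {..<n} \<noteq> 0"
  obtains L where "L \<in> carrier_mat n n" "L * M = 1\<^sub>m n"
proof
  define f where "f = entries M"
  define S where "S = {..<n}"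
  define D where "D = moore_det f S"
  \<comment> \<open>The indicator keeps the walks whose first step enters column \<open>l\<close>.
    Thus \<open>R l j\<close> collects what stands to the right of \<open>f k l\<close> in the sum
    of walks from \<open>k\<close> to \<open>j\<close>.\<close>
  define R where "R l j = (\<Sum>x\<in>dlists (S - {j}).
    ((-1) ^ length x * moore_det f (S - {j} - set x)) *\<^sub>R
      ((if l = hd (x @ [j]) then 1 else 0) * walk f (x @ [j])))" for l j
  define L where "L = mat n n (\<lambda>(j, l). (1 / D) *\<^sub>R quat_cnj (R l j))"
  show "L \<in> carrier_mat n n" by (simp add: L_def)
  have fin: "finite S" by (simp add: S_def)
  have herm': "hermitian_on f S" using herm by (simp add: f_def S_def)
  have R: "(\<Sum>l\<in>S. f k l * R l j) = (if k = j then of_real D else 0)"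
    if k: "k \<in> S" and j: "j \<in> S" for k j
  proof -
    have "(\<Sum>l\<in>S. f k l * R l j) = (\<Sum>x\<in>dlists (S - {j}). \<Sum>l\<in>S.
        f k l * (((-1) ^ length x * moore_det f (S - {j} - set x)) *\<^sub>R
          ((if l = hd (x @ [j]) then 1 else 0) * walk f (x @ [j]))))"
      unfolding R_def sum_distrib_left by (rule sum.swap)
    also have "\<dots> = (\<Sum>x\<in>dlists (S - {j}).
        ((-1) ^ length x * moore_det f (S - {j} - set x)) *\<^sub>R walk f (k # x @ [j]))"
    proof (rule sum.cong[OF refl])
      fix x assume "x \<in> dlists (S - {j})"
      then have hd: "hd (x @ [j]) \<in> S"
        using j by (cases x) (auto simp: dlists_def)
      let ?c = "(-1) ^ length x * moore_det f (S - {j} - set x)"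
      have "(\<Sum>l\<in>S. f k l * (?c *\<^sub>R ((if l = hd (x @ [j]) then 1 else 0) * walk f (x @ [j])))) =
          (\<Sum>l\<in>S. if l = hd (x @ [j]) then ?c *\<^sub>R (f k l * walk f (x @ [j])) else 0)"
        by (intro sum.cong refl) simp
      also have "\<dots> = ?c *\<^sub>R walk f (k # x @ [j])"
        unfolding walk_Cons using fin hd by simp
      finally show "(\<Sum>l\<in>S. f k l * (?c *\<^sub>R ((if l = hd (x @ [j]) then 1 else 0) *
          walk f (x @ [j])))) = ?c *\<^sub>R walk f (k # x @ [j])" .
    qed
    also have "\<dots> = (if k = j then of_real D else 0)"
      unfolding D_def by (rule sum_walks_orthogonal[OF fin k j herm'])
    finally show ?thesis .
  qed
  show "L * M = 1\<^sub>m n"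
  proof (rule eq_matI)
    fix j k assume "j < dim_row (1\<^sub>m n :: quat mat)" "k < dim_col (1\<^sub>m n :: quat mat)"
    then have jk: "j < n" "k < n" "j \<in> S" "k \<in> S" by (auto simp: S_def)
    have "(L * M) $$ (j, k) = (\<Sum>l\<in>S. L $$ (j, l) * f l k)"
      unfolding f_def S_def using jk M by (intro index_mult_entries) (auto simp: L_def)
    also have "\<dots> = (\<Sum>l\<in>S. (1 / D) *\<^sub>R quat_cnj (f k l * R l j))"
    proof (rule sum.cong[OF refl])
      fix l assume l: "l \<in> S"
      have "f l k = quat_cnj (f k l)"
        by (rule hermitian_onD[OF herm' jk(4) l])
      then show "L $$ (j, l) * f l k = (1 / D) *\<^sub>R quat_cnj (f k l * R l j)"
        using jk l by (simp add: L_def S_def)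
    qed
    also have "\<dots> = (1 / D) *\<^sub>R quat_cnj (\<Sum>l\<in>S. f k l * R l j)"
      by (simp only: scaleR_sum_right quat_cnj_sum)
    also have "\<dots> = 1\<^sub>m n $$ (j, k)"
      unfolding R[OF jk(4,3)] using jk nz by (auto simp: D_def f_def S_def of_real_def)
    finally show "(L * M) $$ (j, k) = 1\<^sub>m n $$ (j, k)" .
  qed (use M in \<open>auto simp: L_def\<close>)
qed

section \<open>Gram matrices and the solution of the equation\<close>

lemma qadjoint_carrier: "A \<in> carrier_mat n n \<Longrightarrow> qadjoint A \<in> carrier_mat n n"
  by (auto simp: qadjoint_def)

lemma entries_gram:
  assumes "A \<in> carrier_mat n n" "a < n" "b < n"
  shows "entries (qadjoint A * A) a b = (\<Sum>p<n. quat_cnj (entries A p a) * entries A p b)"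
    and "entries (A * qadjoint A) a b = (\<Sum>p<n. entries A a p * quat_cnj (entries A b p))"
  using assms by (auto simp: entries_def qadjoint_def scalar_prod_def atLeast0LessThan)

lemma hermitian_gram:
  assumes "A \<in> carrier_mat n n"
  shows "hermitian_on (entries (qadjoint A * A)) {..<n}"
    and "hermitian_on (entries (A * qadjoint A)) {..<n}"
  using assms by (auto simp: hermitian_on_def entries_gram quat_cnj_sum)

lemma ddet_eq_moore_det:
  assumes "n \<ge> 1" "A \<in> carrier_mat n n"
  shows "ddet A = moore_det (entries (qadjoint A * A)) {..<n}"
    and "ddet A = moore_det (entries (A * qadjoint A)) {..<n}"
proof -
  show *: "ddet A = moore_det (entries (qadjoint A * A)) {..<n}"
    unfolding ddet_def using assms
    by (intro hdet_eq_moore_det hermitian_gram) (auto simp: qadjoint_def)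
  also have "\<dots> = moore_det (\<lambda>a b. \<Sum>p<n. quat_cnj (entries A p a) * entries A p b) {..<n}"
    by (intro moore_det_cong entries_gram(1)[OF assms(2)]) auto
  also have "\<dots> = moore_det (\<lambda>a b. \<Sum>p<n. entries A a p * quat_cnj (entries A b p)) {..<n}"
    by (rule moore_det_gram)
  also have "\<dots> = moore_det (entries (A * qadjoint A)) {..<n}"
    by (intro moore_det_cong entries_gram(2)[OF assms(2), symmetric]) auto
  finally show "ddet A = moore_det (entries (A * qadjoint A)) {..<n}" .
qed

theorem theorem3p2:
  fixes A B :: "quat mat" and n :: nat
  assumes "n \<ge> 1"
    and "A \<in> carrier_mat n n"
    and "B \<in> carrier_mat n n"
    and "ddet A \<noteq> 0"
  shows "(\<exists>!X. X \<in> carrier_mat n n \<and> X * A = B) \<and>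
    (\<forall>X. X \<in> carrier_mat n n \<and> X * A = B \<longrightarrow>
      (\<forall>i<n. \<forall>j<n. X $$ (i, j) =
        rdet j (replace_row (A * qadjoint A) j (row (B * qadjoint A) i)) / of_real (ddet A)))"
proof -
  note A = assms(2) and B = assms(3)
  have A': "qadjoint A \<in> carrier_mat n n" using A by (rule qadjoint_carrier)
  let ?M = "A * qadjoint A"
  have M: "?M \<in> carrier_mat n n" using A A' by simp
  have formula: "X $$ (i, j) = rdet j (replace_row ?M j (row (B * qadjoint A) i)) / of_real (ddet A)"
    if X: "X \<in> carrier_mat n n" "X * A = B" and ij: "i < n" "j < n" for X i j
  proof -
    \<comment> \<open>Multiplying \<open>X * A = B\<close> on the right by the adjoint shows that
      row \<open>i\<close> of the new right-hand side is a left combination of the rows of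
      \<open>?M\<close> with coefficients \<open>X $$ (i, k)\<close>.\<close>
    have "B * qadjoint A = X * ?M"
      using X A A' by (simp add: assoc_mult_mat[symmetric])
    then have "row (B * qadjoint A) i $ l = (\<Sum>k<n. X $$ (i, k) * entries ?M k l)" if "l < n" for l
      using index_mult_entries[OF X(1) M ij(1) that] that carrier_matD(2)[OF A'] ij(1)
      by (simp add: row_def del: index_mult_mat(1))
    then have "rdet j (replace_row ?M j (row (B * qadjoint A) i)) = X $$ (i, j) * of_real (ddet A)"
      using rdet_replace_row[OF M hermitian_gram(2)[OF A] ij(2), of _ "\<lambda>k. X $$ (i, k)"]
        ddet_eq_moore_det(2)[OF assms(1) A] by simp
    then show ?thesis
      using assms(4) by (simp add: divide_inverse mult.assoc)
  qed
  \<comment> \<open>A left inverse \<open>L\<close> of the other Gram matrix makes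
    \<open>L * qadjoint A\<close> a left inverse of \<open>A\<close>, which provides the solution
    \<open>B * (L * qadjoint A)\<close>.\<close>
  obtain L where L: "L \<in> carrier_mat n n" "L * (qadjoint A * A) = 1\<^sub>m n"
    using hermitian_left_inverse[OF _ hermitian_gram(1)[OF A]] A A' assms(4)
      ddet_eq_moore_det(1)[OF assms(1) A] by (metis mult_carrier_mat)
  have "B * (L * qadjoint A) * A = B * (L * (qadjoint A * A))"
    using A A' B L(1) by (simp add: assoc_mult_mat[of _ n n _ n _ n])
  then have "B * (L * qadjoint A) \<in> carrier_mat n n \<and> B * (L * qadjoint A) * A = B"
    using A' B L by simp
  \<comment> \<open>The formula expresses each entry of a solution through \<open>A\<close> and
    \<open>B\<close> alone, which gives uniqueness.\<close>
  moreover have "X = Y" if "X \<in> carrier_mat n n \<and> X * A = B" "Y \<in> carrier_mat n n \<and> Y * A = B" for X Y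
    using that formula[of X] formula[of Y] by (intro eq_matI) auto
  ultimately show ?thesis
    using formula by (intro conjI ex1I) blast+
qed

end
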